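(* Let $(\mathcal P,\sqsubset)$ be a dual CL-shellable pair, let $1\le i\le \mathrm d(\mathcal P)-1$, and let $F\colon \mathcal P\to R\text{-mod}$ be a functor such that $(\mathcal P,\sqsubset,F)$ has the co-stability property at $i$, i.e. for every unrefinable $\hat 1$-chain $c=(c_0\prec c_1\prec\dots\prec c_i=\hat 1)$ of length $i$ the natural map \[ \operatorname{colim}_{\langle C(c)\rangle}F\to F(c_0) \] is a monomorphism. Then \[ H_i(\mathcal P\setminus\{\hat 1\};F)=0 . \]
   Context: $R$ is a commutative ring with unit. For a poset $\mathcal P$, $p\prec q$ means $p<q$ with no element strictly between. An unrefinable $\hat 1$-chain of length $n$ is a sequence $c=(c_0\prec c_1\prec\dots\prec c_n=\hat 1)$ (length $0$: $c=(\hat 1)$). $\mathcal P$ is filtered if $\mathrm d(p)=\max\{n\mid \exists\, c_0\prec\dots\prec c_n=p\}$ is a well-defined natural number for each $p$ and $\mathrm d$ is strictly order preserving; $\mathrm d(\mathcal P)=\max_p \mathrm d(p)$. A bounded poset is a filtered poset with a maximum $\hat 1$ and a minimum $\hat 0$. Write $\mathcal P_{\prec p}=\{q\mid q\prec p\}$, $\mathcal P_{<p}=\{q\mid q<p\}$, and for $Q\subseteq \mathcal P$, $\langle Q\rangle=\{p\in\mathcal P\mid p\le q\text{ for some }q\in Q\}$. A coatom ordering on a bounded poset $\mathcal P$ is a family $\sqsubset=\{\sqsubset_c\}_c$, indexed by all unrefinable $\hat 1$-chains $c$, where $\sqsubset_c$ is a well-order on $\mathcal P_{\prec c_0}$. For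 $c=(c_0\prec c_1\prec\dots\prec\hat 1)$ of positive length put $c'=(c_1\prec\dots\prec\hat 1)$ and $C(c)=\{x\prec c_0\mid x<h\text{ for some } h\prec c_1\text{ strictly preceding }c_0\text{ in }\sqsubset_{c'}\}$; put $C(\hat 1)=\emptyset$. The pair $(\mathcal P,\sqsubset)$ is dual CL-shellable if for every unrefinable $\hat 1$-chain $c$: (CL0) every initial segment (downward closed subset) of $\sqsubset_c$ is finite or isomorphic to $(\mathbb N,\le)$; (CL1) $C(c)$ is an initial segment of $\sqsubset_c$; (CL2) for $h',h\in\mathcal P_{\prec c_0}$ with $h'$ strictly preceding $h$ in $\sqsubset_c$ and $p\in\mathcal P_{<h}\cap\mathcal P_{<h'}$, there exist $h''\in\mathcal P_{\prec c_0}$ strictly preceding $h$ in $\sqsubset_c$ and $q\in\mathcal P_{\prec h}$ with $p\le q<h''$. For a poset $\mathcal Q$ and $F\colon\mathcal Q\to R\text{-mod}$, $H_*(\mathcal Q;F)$ denotes the left derived functors of $\operatorname{colim}\colon \mathrm{Fun}(\mathcal Q,R\text{-mod})\to R\text{-mod}$ evaluated at $F$ (with $F$ restricted if defined on a larger poset). *)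

theory Defs
  imports "HOL-Algebra.Module" "HOL-Algebra.AbelCoset"
begin

section \<open>Filtered posets and dual CL-shellability\<close>

text \<open>
  The poset is a type: a poset with minimum and maximum is a type of sorts \<^class>\<open>order_bot\<close> and
  \<^class>\<open>order_top\<close>.  Subposets are sets.
\<close>

definition covered_by :: "'p::order \<Rightarrow> 'p \<Rightarrow> bool"  (infix \<open>\<lessdot>\<close> 50) where
  "p \<lessdot> q \<longleftrightarrow> p < q \<and> \<not> (\<exists>r. p < r \<and> r < q)"

text \<open>
  The list \<open>[c\<^sub>0, \<dots>, c\<^sub>n]\<close> of length \<open>n + 1\<close> represents an unrefinable chain of length \<open>n\<close>.
\<close>

definition unrefinable_chain :: "'p::order list \<Rightarrow> bool" where
  "unrefinable_chain c \<longleftrightarrow> c \<noteq> [] \<and> successively (\<lessdot>) c"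

definition top_chain :: "'p::{order,order_top} list \<Rightarrow> bool" where
  "top_chain c \<longleftrightarrow> unrefinable_chain c \<and> last c = top_class.top"

definition chain_lengths :: "'p::order \<Rightarrow> nat set" where
  "chain_lengths p = {n. \<exists>c. unrefinable_chain c \<and> last c = p \<and> length c = Suc n}"

definition depth :: "'p::order \<Rightarrow> nat" where
  "depth p = Max (chain_lengths p)"

text \<open>\<open>chain_lengths p\<close> always contains 0, so its maximum exists iff it is finite.\<close>

definition filtered_poset :: "'p::order itself \<Rightarrow> bool" where
  "filtered_poset _ \<longleftrightarrow>
     (\<forall>p::'p. finite (chain_lengths p)) \<and> (\<forall>p q::'p. p < q \<longrightarrow> depth p < depth q)"

definition poset_depth :: "'p::order itself \<Rightarrow> nat" where
  "poset_depth _ = Max (range (depth :: 'p \<Rightarrow> nat))"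

definition down_closure :: "'p::order set \<Rightarrow> 'p set" where
  "down_closure Q = {p. \<exists>q\<in>Q. p \<le> q}"

text \<open>
  \<open>L c\<close> is the reflexive order relation of \<open>\<sqsubset>\<^sub>c\<close>; values at lists other than unrefinable chains
  ending in the maximum are irrelevant.
\<close>

definition coatom_ordering :: "('p::{order,order_top} list \<Rightarrow> 'p rel) \<Rightarrow> bool" where
  "coatom_ordering L \<longleftrightarrow> (\<forall>c. top_chain c \<longrightarrow> well_order_on {q. q \<lessdot> hd c} (L c))"

definition precedes :: "('p list \<Rightarrow> 'p rel) \<Rightarrow> 'p list \<Rightarrow> 'p \<Rightarrow> 'p \<Rightarrow> bool" where
  "precedes L c h' h \<longleftrightarrow> (h', h) \<in> L c \<and> h' \<noteq> h"

fun Cset :: "('p::order list \<Rightarrow> 'p rel) \<Rightarrow> 'p list \<Rightarrow> 'p set" where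
  "Cset L (c0 # c1 # cs) =
     {x. x \<lessdot> c0 \<and> (\<exists>h. h \<lessdot> c1 \<and> precedes L (c1 # cs) h c0 \<and> x < h)}"
| "Cset L _ = {}"

definition initial_segment :: "'p set \<Rightarrow> 'p rel \<Rightarrow> 'p set \<Rightarrow> bool" where
  "initial_segment A r S \<longleftrightarrow> S \<subseteq> A \<and> (\<forall>x\<in>S. \<forall>y\<in>A. (y, x) \<in> r \<longrightarrow> y \<in> S)"

definition dual_CL_shellable :: "('p::{order_bot,order_top} list \<Rightarrow> 'p rel) \<Rightarrow> bool" where
  "dual_CL_shellable L \<longleftrightarrow>
     filtered_poset TYPE('p) \<and> coatom_ordering L \<and>
     (\<forall>c. top_chain c \<longrightarrow>
       (\<forall>S. initial_segment {q. q \<lessdot> hd c} (L c) S \<longrightarrow> finite S \<or> (Restr (L c) S, natLeq) \<in> ordIso) \<and>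
       initial_segment {q. q \<lessdot> hd c} (L c) (Cset L c) \<and>
       (\<forall>h' h p. h' \<lessdot> hd c \<and> h \<lessdot> hd c \<and> precedes L c h' h \<and> p < h \<and> p < h' \<longrightarrow>
          (\<exists>h'' q. h'' \<lessdot> hd c \<and> precedes L c h'' h \<and> q \<lessdot> h \<and> p \<le> q \<and> q < h'')))"


section \<open>Modules\<close>

definition module_hom :: "('r, 'x) ring_scheme \<Rightarrow> ('r, 'a) module \<Rightarrow> ('r, 'b) module \<Rightarrow> ('a \<Rightarrow> 'b) set"
  where
  "module_hom R M N =
     {f \<in> carrier M \<rightarrow> carrier N.
        (\<forall>x\<in>carrier M. \<forall>y\<in>carrier M. f (x \<oplus>\<^bsub>M\<^esub> y) = f x \<oplus>\<^bsub>N\<^esub> f y) \<and>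
        (\<forall>r\<in>carrier R. \<forall>x\<in>carrier M. f (r \<odot>\<^bsub>M\<^esub> x) = r \<odot>\<^bsub>N\<^esub> f x)}"

text \<open>
  The record type \<^type>\<open>module\<close> extends that of rings; the fields \<open>mult\<close> and \<open>one\<close> play no role in
  the locale \<^locale>\<open>module\<close>.
\<close>

definition direct_sum :: "'p set \<Rightarrow> ('p \<Rightarrow> ('r, 'm) module) \<Rightarrow> ('r, 'p \<Rightarrow> 'm) module" where
  "direct_sum Q M =
     \<lparr>carrier = {x \<in> \<Pi>\<^sub>E q\<in>Q. carrier (M q). finite {q \<in> Q. x q \<noteq> \<zero>\<^bsub>M q\<^esub>}},
      mult = undefined, one = undefined,
      zero = (\<lambda>q\<in>Q. \<zero>\<^bsub>M q\<^esub>),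
      add = (\<lambda>x y. \<lambda>q\<in>Q. x q \<oplus>\<^bsub>M q\<^esub> y q),
      smult = (\<lambda>r x. \<lambda>q\<in>Q. r \<odot>\<^bsub>M q\<^esub> x q)\<rparr>"

definition summand_in :: "'p set \<Rightarrow> ('p \<Rightarrow> ('r, 'm) module) \<Rightarrow> 'p \<Rightarrow> 'm \<Rightarrow> ('p \<Rightarrow> 'm)" where
  "summand_in Q M p x = (\<lambda>q\<in>Q. if q = p then x else \<zero>\<^bsub>M q\<^esub>)"

definition quotient_module :: "('r, 'm) module \<Rightarrow> 'm set \<Rightarrow> ('r, 'm set) module" where
  "quotient_module M N =
     \<lparr>carrier = a_rcosets\<^bsub>M\<^esub> N,
      mult = undefined, one = undefined,
      zero = N,
      add = set_add M,
      smult = (\<lambda>r X. \<Union>x\<in>X. N +>\<^bsub>M\<^esub> (r \<odot>\<^bsub>M\<^esub> x))\<rparr>"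

text \<open>
  For \<open>n > 0\<close>, \<open>d n\<close> is the differential \<open>K n \<rightarrow> K (n - 1)\<close>; \<open>d 0\<close> is not used.
\<close>

definition homology_module ::
  "(nat \<Rightarrow> ('r, 'm) module) \<Rightarrow> (nat \<Rightarrow> 'm \<Rightarrow> 'm) \<Rightarrow> nat \<Rightarrow> ('r, 'm set) module" where
  "homology_module K d n =
     quotient_module
       ((K n)\<lparr>carrier := {z \<in> carrier (K n). n = 0 \<or> d n z = \<zero>\<^bsub>K (n - 1)\<^esub>}\<rparr>)
       (d (Suc n) ` carrier (K (Suc n)))"


section \<open>Functors from a poset to modules and their colimits\<close>

record ('p, 'r, 'm) diagram =
  ob :: "'p \<Rightarrow> ('r, 'm) module"
  arr :: "'p \<Rightarrow> 'p \<Rightarrow> 'm \<Rightarrow> 'm"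

definition functor_on :: "('r, 'x) ring_scheme \<Rightarrow> 'p::order set \<Rightarrow> ('p, 'r, 'm) diagram \<Rightarrow> bool" where
  "functor_on R Q F \<longleftrightarrow>
     (\<forall>p\<in>Q. module R (ob F p)) \<and>
     (\<forall>p\<in>Q. \<forall>q\<in>Q. p \<le> q \<longrightarrow> arr F p q \<in> module_hom R (ob F p) (ob F q)) \<and>
     (\<forall>p\<in>Q. \<forall>x\<in>carrier (ob F p). arr F p p x = x) \<and>
     (\<forall>p\<in>Q. \<forall>q\<in>Q. \<forall>r\<in>Q. p \<le> q \<and> q \<le> r \<longrightarrow>
        (\<forall>x\<in>carrier (ob F p). arr F q r (arr F p q x) = arr F p r x))"

definition nat_trans_on ::
  "('r, 'x) ring_scheme \<Rightarrow> 'p::order set \<Rightarrow> ('p, 'r, 'a) diagram \<Rightarrow> ('p, 'r, 'b) diagram \<Rightarrow>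
   ('p \<Rightarrow> 'a \<Rightarrow> 'b) \<Rightarrow> bool" where
  "nat_trans_on R Q F G \<eta> \<longleftrightarrow>
     (\<forall>p\<in>Q. \<eta> p \<in> module_hom R (ob F p) (ob G p)) \<and>
     (\<forall>p\<in>Q. \<forall>q\<in>Q. p \<le> q \<longrightarrow>
        (\<forall>x\<in>carrier (ob F p). \<eta> q (arr F p q x) = arr G p q (\<eta> p x)))"

definition epi_on ::
  "'p set \<Rightarrow> ('p, 'r, 'a) diagram \<Rightarrow> ('p, 'r, 'b) diagram \<Rightarrow> ('p \<Rightarrow> 'a \<Rightarrow> 'b) \<Rightarrow> bool" where
  "epi_on Q F G \<eta> \<longleftrightarrow> (\<forall>q\<in>Q. \<eta> q ` carrier (ob F q) = carrier (ob G q))"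

definition colim_relations ::
  "('r, 'x) ring_scheme \<Rightarrow> 'p::order set \<Rightarrow> ('p, 'r, 'm) diagram \<Rightarrow> ('p \<Rightarrow> 'm) set" where
  "colim_relations R Q F =
     (let D = direct_sum Q (ob F) in
      \<Inter>{N. submodule N R D \<and>
          (\<forall>p\<in>Q. \<forall>q\<in>Q. p \<le> q \<longrightarrow> (\<forall>x\<in>carrier (ob F p).
             summand_in Q (ob F) p x \<ominus>\<^bsub>D\<^esub> summand_in Q (ob F) q (arr F p q x) \<in> N))})"

definition colim ::
  "('r, 'x) ring_scheme \<Rightarrow> 'p::order set \<Rightarrow> ('p, 'r, 'm) diagram \<Rightarrow> ('r, ('p \<Rightarrow> 'm) set) module" where
  "colim R Q F = quotient_module (direct_sum Q (ob F)) (colim_relations R Q F)"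

definition colim_in ::
  "('r, 'x) ring_scheme \<Rightarrow> 'p::order set \<Rightarrow> ('p, 'r, 'm) diagram \<Rightarrow> 'p \<Rightarrow> 'm \<Rightarrow> ('p \<Rightarrow> 'm) set" where
  "colim_in R Q F q x = colim_relations R Q F +>\<^bsub>direct_sum Q (ob F)\<^esub> summand_in Q (ob F) q x"

text \<open>
  The map out of the colimit of \<open>F\<close> over \<open>Q\<close> induced by a cocone \<open>\<phi>\<close> with vertex \<open>N\<close>: the sum
  below takes the same value on all representatives \<open>x\<close> of a class \<open>X\<close>.
\<close>

definition colim_desc ::
  "'p set \<Rightarrow> ('p, 'r, 'm) diagram \<Rightarrow> ('r, 'n) module \<Rightarrow> ('p \<Rightarrow> 'm \<Rightarrow> 'n) \<Rightarrow> ('p \<Rightarrow> 'm) set \<Rightarrow> 'n" where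
  "colim_desc Q F N \<phi> X =
     the_elem ((\<lambda>x. \<Oplus>\<^bsub>N\<^esub>q\<in>{q \<in> Q. x q \<noteq> \<zero>\<^bsub>ob F q\<^esub>}. \<phi> q (x q)) ` X)"

definition colim_map ::
  "('r, 'x) ring_scheme \<Rightarrow> 'p::order set \<Rightarrow> ('p, 'r, 'm) diagram \<Rightarrow> ('p, 'r, 'n) diagram \<Rightarrow>
   ('p \<Rightarrow> 'm \<Rightarrow> 'n) \<Rightarrow> ('p \<Rightarrow> 'm) set \<Rightarrow> ('p \<Rightarrow> 'n) set" where
  "colim_map R Q F G \<eta> = colim_desc Q F (colim R Q G) (\<lambda>q x. colim_in R Q G q (\<eta> q x))"


section \<open>Left derived functors of the colimit\<close>

text \<open>
  Projectivity of \<open>P\<close> in the category of functors from \<open>Q\<close> to modules.  HOL does not allow the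
  lifting property to quantify over functors with values in arbitrary types.  The element types of
  the test functors \<open>E\<close> and \<open>G\<close> are chosen so that this is no restriction: the free functor
  sending \<open>q\<close> to the free \<open>R\<close>-module on \<open>{(p, x). p \<in> Q \<and> p \<le> q \<and> x \<in> carrier (ob P p)}\<close> has
  elements of type \<open>'p \<times> 'b \<Rightarrow> 'r\<close>, so that lifting the identity along the canonical epimorphism
  onto \<open>G = P\<close> exhibits \<open>P\<close> as a retract of a free functor, whence \<open>P\<close> has the lifting property
  for epimorphisms with elements of any types.
\<close>

definition projective_on ::
  "('r, 'x) ring_scheme \<Rightarrow> 'p::order set \<Rightarrow> ('p, 'r, 'b) diagram \<Rightarrow> bool" where
  "projective_on R Q P \<longleftrightarrow> functor_on R Q P \<and>
     (\<forall>(E :: ('p, 'r, 'p \<times> 'b \<Rightarrow> 'r) diagram) (G :: ('p, 'r, 'b) diagram) \<pi> \<gamma>.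
        functor_on R Q E \<and> functor_on R Q G \<and>
        nat_trans_on R Q E G \<pi> \<and> epi_on Q E G \<pi> \<and> nat_trans_on R Q P G \<gamma> \<longrightarrow>
        (\<exists>\<sigma>. nat_trans_on R Q P E \<sigma> \<and>
             (\<forall>q\<in>Q. \<forall>x\<in>carrier (ob P q). \<pi> q (\<sigma> q x) = \<gamma> q x)))"

text \<open>
  A projective resolution \<open>\<dots> \<rightarrow> P 1 \<rightarrow> P 0 \<rightarrow> F \<rightarrow> 0\<close> with differentials
  \<open>\<delta> n : P n \<rightarrow> P (n - 1)\<close> for \<open>n > 0\<close> and augmentation \<open>\<epsilon>\<close>; exactness is objectwise.
\<close>

definition projective_resolution ::
  "('r, 'x) ring_scheme \<Rightarrow> 'p::order set \<Rightarrow> ('p, 'r, 'm) diagram \<Rightarrow>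
   (nat \<Rightarrow> ('p, 'r, 'b) diagram) \<Rightarrow> (nat \<Rightarrow> 'p \<Rightarrow> 'b \<Rightarrow> 'b) \<Rightarrow> ('p \<Rightarrow> 'b \<Rightarrow> 'm) \<Rightarrow> bool" where
  "projective_resolution R Q F P \<delta> \<epsilon> \<longleftrightarrow>
     (\<forall>n. projective_on R Q (P n)) \<and>
     (\<forall>n. nat_trans_on R Q (P (Suc n)) (P n) (\<delta> (Suc n))) \<and>
     nat_trans_on R Q (P 0) F \<epsilon> \<and> epi_on Q (P 0) F \<epsilon> \<and>
     (\<forall>q\<in>Q. \<delta> 1 q ` carrier (ob (P 1) q) = {x \<in> carrier (ob (P 0) q). \<epsilon> q x = \<zero>\<^bsub>ob F q\<^esub>}) \<and>
     (\<forall>n. \<forall>q\<in>Q. \<delta> (Suc (Suc n)) q ` carrier (ob (P (Suc (Suc n))) q) =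
        {x \<in> carrier (ob (P (Suc n)) q). \<delta> (Suc n) q x = \<zero>\<^bsub>ob (P n) q\<^esub>})"

text \<open>
  The \<open>i\<close>-th left derived functor \<open>H\<^sub>i(Q; F)\<close> of the colimit, computed from a projective resolution
  \<open>(P, \<delta>)\<close> of \<open>F\<close>.  Up to isomorphism it does not depend on the resolution, so statements about
  \<open>H\<^sub>i(Q; F)\<close> are made for all projective resolutions, with elements of an arbitrary type.
\<close>

definition higher_colim ::
  "('r, 'x) ring_scheme \<Rightarrow> 'p::order set \<Rightarrow> (nat \<Rightarrow> ('p, 'r, 'b) diagram) \<Rightarrow>
   (nat \<Rightarrow> 'p \<Rightarrow> 'b \<Rightarrow> 'b) \<Rightarrow> nat \<Rightarrow> ('r, ('p \<Rightarrow> 'b) set set) module" where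
  "higher_colim R Q P \<delta> i =
     homology_module (\<lambda>n. colim R Q (P n)) (\<lambda>n. colim_map R Q (P n) (P (n - 1)) (\<delta> n)) i"


section \<open>Co-stability\<close>

definition co_stable_at ::
  "('r, 'x) ring_scheme \<Rightarrow> ('p::{order_bot,order_top} list \<Rightarrow> 'p rel) \<Rightarrow> ('p, 'r, 'm) diagram \<Rightarrow>
   nat \<Rightarrow> bool" where
  "co_stable_at R L F i \<longleftrightarrow>
     (\<forall>c. top_chain c \<and> length c = Suc i \<longrightarrow>
        inj_on (colim_desc (down_closure (Cset L c)) F (ob F (hd c)) (\<lambda>q. arr F q (hd c)))
               (carrier (colim R (down_closure (Cset L c)) F)))"

end

theory Submission
  imports Defs
begin

text \<open>
  Attach the coatoms of an interval one at a time, in the given order.  By (CL2), the part of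
  \<open>\<langle>x\<rangle>\<close> already present when the coatom \<open>x\<close> of \<open>c\<^sub>0\<close> is attached is \<open>\<langle>C(x, c)\<rangle>\<close>, which by (CL1)
  is again spanned by an initial segment of coatoms, now of \<open>x\<close>.  Since \<open>\<langle>x\<rangle>\<close> has a maximum, a
  Mayer--Vietoris argument reduces the vanishing of \<open>H\<^sub>j\<close> for initial segments below \<open>c\<^sub>0\<close> to that of
  \<open>H\<^sub>j\<^sub>-\<^sub>1\<close> for \<open>\<langle>C(x, c)\<rangle>\<close>.  Each step lengthens the chain by one, so that \<open>H\<^sub>1\<close> is reached exactly
  for chains of length \<open>i - 1\<close>, where the injectivity needed is co-stability at \<open>i\<close>.

  Everything takes place inside the complex of colimits over all of \<open>\<P> - {\<top>}\<close>: for projective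
  \<open>P\<close>, the colimits over lower sets are submodules of the full colimit, and intersections of lower
  sets correspond to intersections of submodules.  Transfinite induction along the orders suffices;
  their order type plays no role.
\<close>

section \<open>Modules\<close>

text \<open>The hypothesis at the bottom of the induction is an injectivity, while everywhere above
  it a vanishing is available. Both enter as one condition: H_n(C) -> H_n(<x>) is injective for C =
  <C(x, c)>. This suffices, because a class of H_{n+1} of the enlarged set that the connecting map
  sends to zero comes from the two pieces, whose H_{n+1} vanishes. For n > 0 the condition follows
  from H_n(C) = 0; for n = 0 it says that colim_C F -> F(x) is injective, since H_0(<x>) = F(x). The
  obstacle is that Mayer--Vietoris requires the submodules spanned by A and B to meet in the one
  spanned by their intersection. This fails for general functors: two incomparable points below a
  third each span the whole colimit of a nonzero constant functor. A projective functor is a retract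
  of a free one, and the colimit of a free functor has coordinates indexed by pairs (p, a). For an
  element spanned by a lower set A these coordinates have p in A, and they determine the element.
  Staying inside one complex also avoids restricting the resolution to subposets.\<close>

lemma module_homD:
  assumes "f \<in> module_hom R M N"
  shows "x \<in> carrier M \<Longrightarrow> f x \<in> carrier N"
    and "x \<in> carrier M \<Longrightarrow> y \<in> carrier M \<Longrightarrow> f (x \<oplus>\<^bsub>M\<^esub> y) = f x \<oplus>\<^bsub>N\<^esub> f y"
    and "r \<in> carrier R \<Longrightarrow> x \<in> carrier M \<Longrightarrow> f (r \<odot>\<^bsub>M\<^esub> x) = r \<odot>\<^bsub>N\<^esub> f x"
  using assms by (auto simp: module_hom_def)

lemma module_homI:
  assumes "\<And>x. x \<in> carrier M \<Longrightarrow> f x \<in> carrier N"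
    and "\<And>x y. x \<in> carrier M \<Longrightarrow> y \<in> carrier M \<Longrightarrow> f (x \<oplus>\<^bsub>M\<^esub> y) = f x \<oplus>\<^bsub>N\<^esub> f y"
    and "\<And>r x. r \<in> carrier R \<Longrightarrow> x \<in> carrier M \<Longrightarrow> f (r \<odot>\<^bsub>M\<^esub> x) = r \<odot>\<^bsub>N\<^esub> f x"
  shows "f \<in> module_hom R M N"
  using assms by (auto simp: module_hom_def)

lemma module_hom_comp:
  assumes "f \<in> module_hom R L M" "g \<in> module_hom R M N"
  shows "(\<lambda>x. g (f x)) \<in> module_hom R L N"
  using module_homD[OF assms(1)] module_homD[OF assms(2)] by (intro module_homI) auto

lemma zero_hom:
  assumes "module R M" "module R V"
  shows "(\<lambda>r. \<zero>\<^bsub>V\<^esub>) \<in> module_hom R M V"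
proof -
  interpret V: module R V by fact
  show ?thesis by (rule module_homI) auto
qed

lemma module_hom_group_hom:
  assumes "f \<in> module_hom R M N" "module R M" "module R N"
  shows "abelian_group_hom M N f"
proof -
  interpret M: module R M by fact
  interpret N: module R N by fact
  show ?thesis
    using module_homD[OF assms(1)]
    by (intro abelian_group_homI group_hom.intro group_hom_axioms.intro M.a_group N.a_group
        M.abelian_group_axioms N.abelian_group_axioms homI) auto
qed

lemma module_hom_finsum:
  assumes "f \<in> module_hom R M N" "module R M" "module R N" and "finite T" "g \<in> T \<rightarrow> carrier M"
  shows "f (\<Oplus>\<^bsub>M\<^esub>i\<in>T. g i) = (\<Oplus>\<^bsub>N\<^esub>i\<in>T. f (g i))"
proof -
  interpret M: module R M by fact
  interpret N: module R N by fact
  interpret f: abelian_group_hom M N f by (rule module_hom_group_hom) fact+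
  show ?thesis
    using assms(4,5)
  proof (induction T rule: finite_induct)
    case (insert i T)
    then show ?case by (simp add: Pi_iff)
  qed simp
qed

section \<open>Submodules and quotient modules\<close>

lemma submodule_kernel:
  assumes "f \<in> module_hom R M N" "module R M" "module R N"
  shows "submodule {x \<in> carrier M. f x = \<zero>\<^bsub>N\<^esub>} R M"
proof -
  interpret M: module R M by fact
  interpret N: module R N by fact
  interpret f: abelian_group_hom M N f by (rule module_hom_group_hom) fact+
  show ?thesis
    using module_homD[OF assms(1)] by (intro M.submoduleI) auto
qed

lemma submodule_image:
  assumes "f \<in> module_hom R M N" "module R M" "module R N" "submodule H R M"
  shows "submodule (f ` H) R N"
proof -
  interpret M: module R M by fact
  interpret N: module R N by fact
  interpret f: abelian_group_hom M N f by (rule module_hom_group_hom) fact+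
  note H = M.submoduleE[OF assms(4)]
  show ?thesis
  proof (rule N.submoduleI)
    show "f ` H \<subseteq> carrier N" using H(1) by auto
    show "\<zero>\<^bsub>N\<^esub> \<in> f ` H"
      using imageI[OF subgroup.one_closed[OF submodule.axioms(1)[OF assms(4)]], of f] by simp
    show "\<ominus>\<^bsub>N\<^esub> v \<in> f ` H" if v: "v \<in> f ` H" for v
    proof -
      from v obtain x where "x \<in> H" "v = f x" by auto
      then show ?thesis using imageI[OF H(3), of x f] H(1) by (simp add: subset_iff)
    qed
    show "u \<oplus>\<^bsub>N\<^esub> v \<in> f ` H" if uv: "u \<in> f ` H" "v \<in> f ` H" for u v
    proof -
      from uv obtain x y where "x \<in> H" "u = f x" "y \<in> H" "v = f y" by auto
      then show ?thesis using imageI[OF H(5), of x y f] H(1) by (simp add: subset_iff)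
    qed
    show "r \<odot>\<^bsub>N\<^esub> v \<in> f ` H" if r: "r \<in> carrier R" and v: "v \<in> f ` H" for r v
    proof -
      from v obtain x where "x \<in> H" "v = f x" by auto
      then show ?thesis
        using imageI[OF H(4)[OF r], of x f] H(1) module_homD(3)[OF assms(1) r] by (simp add: subset_iff)
    qed
  qed
qed

lemma submodule_vimage:
  assumes "f \<in> module_hom R M N" "module R M" "module R N" "submodule H R N"
  shows "submodule {x \<in> carrier M. f x \<in> H} R M"
proof -
  interpret M: module R M by fact
  interpret N: module R N by fact
  interpret f: abelian_group_hom M N f by (rule module_hom_group_hom) fact+
  note H = N.submoduleE[OF assms(4)]
  have "\<zero>\<^bsub>N\<^esub> \<in> H" using subgroup.one_closed[OF submodule.axioms(1)[OF assms(4)]] by simp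
  then show ?thesis
    using H(3-5) module_homD(3)[OF assms(1)] by (intro M.submoduleI) auto
qed

lemma submodule_Inter:
  assumes "module R M" "\<N> \<noteq> {}" "\<And>N. N \<in> \<N> \<Longrightarrow> submodule N R M"
  shows "submodule (\<Inter>\<N>) R M"
proof -
  interpret M: module R M by fact
  note E = M.submoduleE[OF assms(3)]
  have zero: "\<zero>\<^bsub>M\<^esub> \<in> N" if "N \<in> \<N>" for N
    using subgroup.one_closed[OF submodule.axioms(1)[OF assms(3)[OF that]]] by simp
  show ?thesis
  proof (rule M.submoduleI)
    show "\<Inter>\<N> \<subseteq> carrier M" using E(1) assms(2) by blast
  qed (use zero E(3-5) in blast)+
qed

lemma submodule_zero: "submodule N R M \<Longrightarrow> \<zero>\<^bsub>M\<^esub> \<in> N"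
  using subgroup.one_closed[OF submodule.axioms(1), of N R M] by simp

lemma submodule_finsum:
  assumes "module R M" "submodule H R M" "finite T" "\<And>t. t \<in> T \<Longrightarrow> g t \<in> H"
  shows "(\<Oplus>\<^bsub>M\<^esub>t\<in>T. g t) \<in> H"
proof -
  interpret M: module R M by fact
  note H = M.submoduleE[OF assms(2)]
  show ?thesis
    using assms(3,4)
  proof (induction T rule: finite_induct)
    case (insert t T)
    then have "g \<in> T \<rightarrow> carrier M" "g t \<in> carrier M" using H(1) by auto
    with insert H(5) show ?case by simp
  qed (simp add: submodule_zero[OF assms(2)])
qed

lemma submodule_abelian_subgroup:
  assumes "module R M" "submodule N R M"
  shows "abelian_subgroup N M"
proof -
  interpret M: module R M by fact
  show ?thesis
    by (rule abelian_subgroupI3[OF additive_subgroupI[OF submodule.axioms(1)[OF assms(2)]]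
          M.abelian_group_axioms])
qed

lemma module_quotient:
  assumes "module R M" "submodule N R M"
  shows "module R (quotient_module M N)"
    and "(\<lambda>x. N +>\<^bsub>M\<^esub> x) \<in> module_hom R M (quotient_module M N)"
proof -
  interpret M: module R M by fact
  interpret N: abelian_subgroup N M by (rule submodule_abelian_subgroup) fact+
  let ?K = "quotient_module M N"
  have carr: "carrier ?K = (\<lambda>x. N +>\<^bsub>M\<^esub> x) ` carrier M"
    by (auto simp: quotient_module_def A_RCOSETS_def')
  have add: "(N +>\<^bsub>M\<^esub> x) \<oplus>\<^bsub>?K\<^esub> (N +>\<^bsub>M\<^esub> y) = N +>\<^bsub>M\<^esub> (x \<oplus>\<^bsub>M\<^esub> y)"
    if "x \<in> carrier M" "y \<in> carrier M" for x y
    using N.a_rcos_sum[OF that] by (simp add: quotient_module_def)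
  have smult: "r \<odot>\<^bsub>?K\<^esub> (N +>\<^bsub>M\<^esub> x) = N +>\<^bsub>M\<^esub> (r \<odot>\<^bsub>M\<^esub> x)" if "r \<in> carrier R" "x \<in> carrier M" for r x
  proof -
    \<comment> \<open>The scalar multiple of a coset is a union over its representatives. All terms
      of this union are the same coset, and there is at least one term.\<close>
    have eq: "N +>\<^bsub>M\<^esub> (r \<odot>\<^bsub>M\<^esub> y) = N +>\<^bsub>M\<^esub> (r \<odot>\<^bsub>M\<^esub> x)" if y: "y \<in> N +>\<^bsub>M\<^esub> x" for y
    proof -
      from y obtain n where n: "n \<in> N" "y = n \<oplus>\<^bsub>M\<^esub> x" by (auto simp: a_r_coset_def')
      then have "r \<odot>\<^bsub>M\<^esub> y = r \<odot>\<^bsub>M\<^esub> n \<oplus>\<^bsub>M\<^esub> r \<odot>\<^bsub>M\<^esub> x"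
        using that \<open>x \<in> carrier M\<close> \<open>r \<in> carrier R\<close> by (simp add: M.smult_r_distr)
      moreover have "r \<odot>\<^bsub>M\<^esub> n \<in> N"
        using n \<open>r \<in> carrier R\<close> M.submoduleE(4)[OF assms(2)] by blast
      ultimately have "r \<odot>\<^bsub>M\<^esub> y \<in> N +>\<^bsub>M\<^esub> (r \<odot>\<^bsub>M\<^esub> x)"
        by (auto simp: a_r_coset_def')
      then show ?thesis
        using N.a_repr_independence'[of "r \<odot>\<^bsub>M\<^esub> y" "r \<odot>\<^bsub>M\<^esub> x"] \<open>x \<in> carrier M\<close> \<open>r \<in> carrier R\<close> by simp
    qed
    have "N +>\<^bsub>M\<^esub> x \<noteq> {}" using N.a_rcos_self[of x] that by auto
    then show ?thesis using SUP_eq_const[OF _ eq] by (simp add: quotient_module_def)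
  qed
  have group: "abelian_group ?K"
  proof (rule abelian_groupI)
    fix X assume "X \<in> carrier ?K"
    then obtain x where x: "x \<in> carrier M" "X = N +>\<^bsub>M\<^esub> x" by (auto simp: carr)
    have zero: "\<zero>\<^bsub>?K\<^esub> = N +>\<^bsub>M\<^esub> \<zero>\<^bsub>M\<^esub>" using N.a_subset by (simp add: quotient_module_def)
    show "\<zero>\<^bsub>?K\<^esub> \<oplus>\<^bsub>?K\<^esub> X = X" using x by (simp add: zero add)
    have "(N +>\<^bsub>M\<^esub> (\<ominus>\<^bsub>M\<^esub> x)) \<oplus>\<^bsub>?K\<^esub> X = \<zero>\<^bsub>?K\<^esub>" using x by (simp add: zero add M.l_neg)
    then show "\<exists>Y\<in>carrier ?K. Y \<oplus>\<^bsub>?K\<^esub> X = \<zero>\<^bsub>?K\<^esub>" using x by (auto simp: carr)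
  next
    have "\<zero>\<^bsub>?K\<^esub> = N +>\<^bsub>M\<^esub> \<zero>\<^bsub>M\<^esub>" using N.a_subset by (simp add: quotient_module_def)
    then show "\<zero>\<^bsub>?K\<^esub> \<in> carrier ?K" by (auto simp: carr)
  qed (auto simp: carr add M.a_ac)
  show "module R ?K"
    by (rule moduleI[OF M.is_cring group])
      (auto simp: carr add smult M.smult_l_distr M.smult_r_distr M.smult_assoc1)
  show "(\<lambda>x. N +>\<^bsub>M\<^esub> x) \<in> module_hom R M ?K"
    by (rule module_homI) (auto simp: carr add smult)
qed

section \<open>Direct sums\<close>

lemma direct_sum_sel:
  "x \<in> carrier (direct_sum Q M) \<longleftrightarrow>
    x \<in> extensional Q \<and> (\<forall>q\<in>Q. x q \<in> carrier (M q)) \<and> finite {q \<in> Q. x q \<noteq> \<zero>\<^bsub>M q\<^esub>}"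
  "\<zero>\<^bsub>direct_sum Q M\<^esub> = (\<lambda>q\<in>Q. \<zero>\<^bsub>M q\<^esub>)"
  "x \<oplus>\<^bsub>direct_sum Q M\<^esub> y = (\<lambda>q\<in>Q. x q \<oplus>\<^bsub>M q\<^esub> y q)"
  "r \<odot>\<^bsub>direct_sum Q M\<^esub> x = (\<lambda>q\<in>Q. r \<odot>\<^bsub>M q\<^esub> x q)"
  by (auto simp: direct_sum_def PiE_iff)

lemma direct_sum_carrier_cases:
  assumes "x \<in> carrier (direct_sum Q M)"
  shows "q \<in> Q \<Longrightarrow> x q \<in> carrier (M q)" and "finite {q \<in> Q. x q \<noteq> \<zero>\<^bsub>M q\<^esub>}" and "x \<in> extensional Q"
  using assms by (auto simp: direct_sum_sel)

lemma module_direct_sum: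
  assumes "cring R" "\<And>q. q \<in> Q \<Longrightarrow> module R (M q)"
  shows "module R (direct_sum Q M)"
proof -
  let ?D = "direct_sum Q M"
  have grp: "abelian_group (M q)" if "q \<in> Q" for q
    using module.axioms(2)[OF assms(2)[OF that]] .
  have minus_zero: "\<ominus>\<^bsub>M q\<^esub> \<zero>\<^bsub>M q\<^esub> = \<zero>\<^bsub>M q\<^esub>" if "q \<in> Q" for q
  proof -
    interpret abelian_group "M q" by (rule grp[OF that])
    show ?thesis by simp
  qed
  note G = abelian_groupE[OF grp]
  have add_closed: "x \<oplus>\<^bsub>?D\<^esub> y \<in> carrier ?D" if "x \<in> carrier ?D" "y \<in> carrier ?D" for x y
  proof -
    have "{q \<in> Q. (x \<oplus>\<^bsub>?D\<^esub> y) q \<noteq> \<zero>\<^bsub>M q\<^esub>} \<subseteq> {q \<in> Q. x q \<noteq> \<zero>\<^bsub>M q\<^esub>} \<union> {q \<in> Q. y q \<noteq> \<zero>\<^bsub>M q\<^esub>}"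
      by (auto simp: direct_sum_sel G(2,5))
    from finite_subset[OF this] show ?thesis
      using that by (auto simp: direct_sum_sel G)
  qed
  have smult_closed: "r \<odot>\<^bsub>?D\<^esub> x \<in> carrier ?D" if "r \<in> carrier R" "x \<in> carrier ?D" for r x
  proof -
    have "{q \<in> Q. (r \<odot>\<^bsub>?D\<^esub> x) q \<noteq> \<zero>\<^bsub>M q\<^esub>} \<subseteq> {q \<in> Q. x q \<noteq> \<zero>\<^bsub>M q\<^esub>}"
      using that by (auto simp: direct_sum_sel module.smult_r_null[OF assms(2)])
    from finite_subset[OF this] show ?thesis
      using that by (auto simp: direct_sum_sel module.smult_closed[OF assms(2)])
  qed
  have neg: "\<exists>y\<in>carrier ?D. y \<oplus>\<^bsub>?D\<^esub> x = \<zero>\<^bsub>?D\<^esub>" if "x \<in> carrier ?D" for x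
  proof
    let ?y = "\<lambda>q\<in>Q. \<ominus>\<^bsub>M q\<^esub> x q"
    have "{q \<in> Q. ?y q \<noteq> \<zero>\<^bsub>M q\<^esub>} \<subseteq> {q \<in> Q. x q \<noteq> \<zero>\<^bsub>M q\<^esub>}"
      using minus_zero by auto
    from finite_subset[OF this] show "?y \<in> carrier ?D"
      using that by (auto simp: direct_sum_sel abelian_group.a_inv_closed[OF grp])
    show "?y \<oplus>\<^bsub>?D\<^esub> x = \<zero>\<^bsub>?D\<^esub>"
      using that by (auto simp: direct_sum_sel abelian_group.l_neg[OF grp])
  qed
  have group: "abelian_group ?D"
  proof (rule abelian_groupI)
    fix x y assume "x \<in> carrier ?D" "y \<in> carrier ?D"
    then show "x \<oplus>\<^bsub>?D\<^esub> y = y \<oplus>\<^bsub>?D\<^esub> x"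
      by (auto simp: direct_sum_sel fun_eq_iff intro: G(4))
  qed (auto simp: add_closed neg, auto simp: direct_sum_sel G(1-3,5) fun_eq_iff extensional_def)
  show ?thesis
    by (rule moduleI[OF assms(1) group])
      (auto simp: smult_closed,
        auto simp: direct_sum_sel fun_eq_iff extensional_def
          module.smult_l_distr[OF assms(2)] module.smult_r_distr[OF assms(2)]
          module.smult_assoc1[OF assms(2)] module.smult_one[OF assms(2)])
qed

text \<open>This is the sum inside \<open>colim_desc\<close>, isolated so that the universal
  property of the direct sum is available before any relations are divided out.\<close>

definition direct_sum_desc ::
  "'i set \<Rightarrow> ('i \<Rightarrow> ('r, 'm) module) \<Rightarrow> ('r, 'n) module \<Rightarrow> ('i \<Rightarrow> 'm \<Rightarrow> 'n) \<Rightarrow> ('i \<Rightarrow> 'm) \<Rightarrow> 'n" where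
  "direct_sum_desc Q M V \<phi> x = (\<Oplus>\<^bsub>V\<^esub>q\<in>{q \<in> Q. x q \<noteq> \<zero>\<^bsub>M q\<^esub>}. \<phi> q (x q))"

lemma summand_in_carrier:
  assumes "\<And>q. q \<in> Q \<Longrightarrow> module R (M q)" "p \<in> Q" "x \<in> carrier (M p)"
  shows "summand_in Q M p x \<in> carrier (direct_sum Q M)"
proof -
  have "\<zero>\<^bsub>M q\<^esub> \<in> carrier (M q)" if "q \<in> Q" for q
    using abelian_groupE(2)[OF module.axioms(2)[OF assms(1)[OF that]]] .
  moreover have "finite {q \<in> Q. summand_in Q M p x q \<noteq> \<zero>\<^bsub>M q\<^esub>}"
    by (rule finite_subset[of _ "{p}"]) (auto simp: summand_in_def)
  ultimately show ?thesis
    using assms(2,3) by (auto simp: direct_sum_sel summand_in_def)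
qed

lemma direct_sum_induct:
  assumes mod: "\<And>q. q \<in> Q \<Longrightarrow> module R (M q)"
    and x: "x \<in> carrier (direct_sum Q M)"
    and zero: "P \<zero>\<^bsub>direct_sum Q M\<^esub>"
    and add: "\<And>p a x. p \<in> Q \<Longrightarrow> a \<in> carrier (M p) \<Longrightarrow> x \<in> carrier (direct_sum Q M) \<Longrightarrow> P x \<Longrightarrow>
                P (summand_in Q M p a \<oplus>\<^bsub>direct_sum Q M\<^esub> x)"
  shows "P x"
proof -
  note G = abelian_groupE[OF module.axioms(2)[OF mod]]
  \<comment> \<open>The induction runs over a finite set that contains the support, so that erasing
    the coordinate at \<open>p\<close> always leads to an instance of the hypothesis for
    \<open>T\<close>.\<close>
  have "\<lbrakk>finite T; T \<subseteq> Q; x \<in> carrier (direct_sum Q M); {q \<in> Q. x q \<noteq> \<zero>\<^bsub>M q\<^esub>} \<subseteq> T\<rbrakk> \<Longrightarrow> P x" for T x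
  proof (induction T arbitrary: x rule: finite_induct)
    case empty
    then have "x = \<zero>\<^bsub>direct_sum Q M\<^esub>" by (auto simp: direct_sum_sel fun_eq_iff extensional_def)
    with zero show ?case by simp
  next
    case (insert p T)
    let ?y = "x(p := \<zero>\<^bsub>M p\<^esub>)"
    have "p \<in> Q" using insert by auto
    have fin: "finite {q \<in> Q. ?y q \<noteq> \<zero>\<^bsub>M q\<^esub>}"
      by (rule finite_subset[OF _ insert(1)]) (use insert in auto)
    have y: "?y \<in> carrier (direct_sum Q M)"
      using insert.prems \<open>p \<in> Q\<close> fin by (auto simp: direct_sum_sel G extensional_def)
    have "P ?y" by (rule insert.IH[OF _ y]) (use insert in auto)
    then have "P (summand_in Q M p (x p) \<oplus>\<^bsub>direct_sum Q M\<^esub> ?y)"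
      using \<open>p \<in> Q\<close> insert.prems y by (intro add) (auto simp: direct_sum_sel)
    moreover have "summand_in Q M p (x p) \<oplus>\<^bsub>direct_sum Q M\<^esub> ?y = x"
    proof
      fix q
      have "x q \<in> carrier (M q)" if "q \<in> Q" using that insert.prems by (auto simp: direct_sum_sel)
      then show "(summand_in Q M p (x p) \<oplus>\<^bsub>direct_sum Q M\<^esub> ?y) q = x q"
        using insert.prems \<open>p \<in> Q\<close> abelian_monoid.r_zero[OF abelian_group.axioms(1)[OF module.axioms(2)[OF mod]], of q "x q"]
        by (cases "q \<in> Q") (auto simp: direct_sum_sel summand_in_def G extensional_def)
    qed
    ultimately show ?case by simp
  qed
  from this[OF _ _ x subset_refl] show ?thesis
    using x by (auto simp: direct_sum_sel)
qed

context
  fixes R :: "('r, 'x) ring_scheme" and Q :: "'i set" and M :: "'i \<Rightarrow> ('r, 'm) module"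
    and V :: "('r, 'n) module" and \<phi> :: "'i \<Rightarrow> 'm \<Rightarrow> 'n"
  assumes mod: "\<And>q. q \<in> Q \<Longrightarrow> module R (M q)" and V: "module R V"
    and \<phi>: "\<And>q. q \<in> Q \<Longrightarrow> \<phi> q \<in> module_hom R (M q) V"
begin

interpretation V: module R V by (fact V)

text \<open>Sums and multiples of families may have other supports than the families themselves.
  Linearity is therefore checked over a common finite index set; the added terms vanish because each
  \<open>\<phi> q\<close> maps zero to zero.\<close>

lemma direct_sum_desc_superset:
  assumes "x \<in> carrier (direct_sum Q M)" "finite T" "T \<subseteq> Q" "{q \<in> Q. x q \<noteq> \<zero>\<^bsub>M q\<^esub>} \<subseteq> T"
  shows "direct_sum_desc Q M V \<phi> x = (\<Oplus>\<^bsub>V\<^esub>q\<in>T. \<phi> q (x q))"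
  unfolding direct_sum_desc_def
proof (rule V.add.finprod_mono_neutral_cong_left)
  show "(\<lambda>q. \<phi> q (x q)) \<in> T \<rightarrow> carrier V"
    using assms(1,3) module_homD(1)[OF \<phi>] by (auto simp: direct_sum_sel)
  fix q assume "q \<in> T - {q \<in> Q. x q \<noteq> \<zero>\<^bsub>M q\<^esub>}"
  then have "q \<in> Q" "x q = \<zero>\<^bsub>M q\<^esub>" using assms(3) by auto
  then show "\<phi> q (x q) = \<zero>\<^bsub>V\<^esub>"
    using abelian_group_hom.hom_zero[OF module_hom_group_hom[OF \<phi> mod V]] by auto
qed (use assms in auto)

lemma direct_sum_desc_hom: "direct_sum_desc Q M V \<phi> \<in> module_hom R (direct_sum Q M) V"
proof (rule module_homI)
  let ?D = "direct_sum Q M"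
  interpret D: module R ?D by (rule module_direct_sum[OF V.is_cring mod])
  have tm: "\<phi> q (x q) \<in> carrier V" if "x \<in> carrier ?D" "q \<in> Q" for x q
    using that module_homD(1)[OF \<phi>] by (auto simp: direct_sum_sel)
  fix x assume x: "x \<in> carrier ?D"
  let ?S = "{q \<in> Q. x q \<noteq> \<zero>\<^bsub>M q\<^esub>}"
  show "direct_sum_desc Q M V \<phi> x \<in> carrier V"
    unfolding direct_sum_desc_def by (rule V.finsum_closed) (use tm[OF x] in auto)
  show "direct_sum_desc Q M V \<phi> (x \<oplus>\<^bsub>?D\<^esub> y) = direct_sum_desc Q M V \<phi> x \<oplus>\<^bsub>V\<^esub> direct_sum_desc Q M V \<phi> y"
    if y: "y \<in> carrier ?D" for y
  proof -
    let ?T = "?S \<union> {q \<in> Q. y q \<noteq> \<zero>\<^bsub>M q\<^esub>}"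
    have T: "finite ?T" "?T \<subseteq> Q" using x y by (auto simp: direct_sum_sel)
    have supp: "{q \<in> Q. (x \<oplus>\<^bsub>?D\<^esub> y) q \<noteq> \<zero>\<^bsub>M q\<^esub>} \<subseteq> ?T"
      using abelian_groupE(2,5)[OF module.axioms(2)[OF mod]] by (auto simp: direct_sum_sel)
    have "direct_sum_desc Q M V \<phi> (x \<oplus>\<^bsub>?D\<^esub> y) = (\<Oplus>\<^bsub>V\<^esub>q\<in>?T. \<phi> q ((x \<oplus>\<^bsub>?D\<^esub> y) q))"
      by (rule direct_sum_desc_superset[OF D.a_closed[OF x y] T supp])
    also have "\<dots> = (\<Oplus>\<^bsub>V\<^esub>q\<in>?T. \<phi> q (x q) \<oplus>\<^bsub>V\<^esub> \<phi> q (y q))"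
      using T x y tm by (intro V.finsum_cong' refl) (auto simp: direct_sum_sel module_homD(2)[OF \<phi>])
    also have "\<dots> = (\<Oplus>\<^bsub>V\<^esub>q\<in>?T. \<phi> q (x q)) \<oplus>\<^bsub>V\<^esub> (\<Oplus>\<^bsub>V\<^esub>q\<in>?T. \<phi> q (y q))"
      using tm[OF x] tm[OF y] by (intro V.finsum_addf) auto
    also have "(\<Oplus>\<^bsub>V\<^esub>q\<in>?T. \<phi> q (x q)) = direct_sum_desc Q M V \<phi> x"
      by (rule direct_sum_desc_superset[symmetric, OF x T]) auto
    also have "(\<Oplus>\<^bsub>V\<^esub>q\<in>?T. \<phi> q (y q)) = direct_sum_desc Q M V \<phi> y"
      by (rule direct_sum_desc_superset[symmetric, OF y T]) auto
    finally show ?thesis .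
  qed
  show "direct_sum_desc Q M V \<phi> (r \<odot>\<^bsub>?D\<^esub> x) = r \<odot>\<^bsub>V\<^esub> direct_sum_desc Q M V \<phi> x"
    if r: "r \<in> carrier R" for r
  proof -
    have S: "finite ?S" using x by (auto simp: direct_sum_sel)
    have supp: "{q \<in> Q. (r \<odot>\<^bsub>?D\<^esub> x) q \<noteq> \<zero>\<^bsub>M q\<^esub>} \<subseteq> ?S"
      using r module.smult_r_null[OF mod] by (auto simp: direct_sum_sel)
    have "direct_sum_desc Q M V \<phi> (r \<odot>\<^bsub>?D\<^esub> x) = (\<Oplus>\<^bsub>V\<^esub>q\<in>?S. \<phi> q ((r \<odot>\<^bsub>?D\<^esub> x) q))"
      by (rule direct_sum_desc_superset[OF D.smult_closed[OF r x] S _ supp]) auto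
    also have "\<dots> = (\<Oplus>\<^bsub>V\<^esub>q\<in>?S. r \<odot>\<^bsub>V\<^esub> \<phi> q (x q))"
      using x r tm by (intro V.finsum_cong' refl) (auto simp: direct_sum_sel module_homD(3)[OF \<phi>])
    also have "\<dots> = r \<odot>\<^bsub>V\<^esub> direct_sum_desc Q M V \<phi> x"
      unfolding direct_sum_desc_def
      using S r tm[OF x] by (intro V.finsum_smult_ldistr[symmetric]) auto
    finally show ?thesis .
  qed
qed

lemma direct_sum_desc_summand:
  assumes "p \<in> Q" "x \<in> carrier (M p)"
  shows "direct_sum_desc Q M V \<phi> (summand_in Q M p x) = \<phi> p x"
proof -
  have "direct_sum_desc Q M V \<phi> (summand_in Q M p x) = (\<Oplus>\<^bsub>V\<^esub>q\<in>{p}. \<phi> q (summand_in Q M p x q))"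
    using assms by (intro direct_sum_desc_superset summand_in_carrier[OF mod])
      (auto simp: summand_in_def)
  also have "\<dots> = \<phi> p x"
    using assms V.finsum_insert[of "{}" p] module_homD(1)[OF \<phi>[OF assms(1)]] by (simp add: summand_in_def)
  finally show ?thesis .
qed

lemma hom_direct_sum_desc:
  assumes "h \<in> module_hom R V W" "module R W" "x \<in> carrier (direct_sum Q M)"
  shows "h (direct_sum_desc Q M V \<phi> x) = direct_sum_desc Q M W (\<lambda>q a. h (\<phi> q a)) x"
  unfolding direct_sum_desc_def
proof (rule module_hom_finsum[OF assms(1) V assms(2)])
  show "finite {q \<in> Q. x q \<noteq> \<zero>\<^bsub>M q\<^esub>}" using assms(3) by (rule direct_sum_carrier_cases)
  show "(\<lambda>q. \<phi> q (x q)) \<in> {q \<in> Q. x q \<noteq> \<zero>\<^bsub>M q\<^esub>} \<rightarrow> carrier V"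
    using module_homD(1)[OF \<phi>] direct_sum_carrier_cases(1)[OF assms(3)] by simp
qed

end

lemma direct_sum_desc_cong:
  assumes "abelian_group V"
    and "\<And>q. q \<in> Q \<Longrightarrow> x q \<noteq> \<zero>\<^bsub>M q\<^esub> \<Longrightarrow> \<phi> q (x q) = \<psi> q (x q) \<and> \<psi> q (x q) \<in> carrier V"
  shows "direct_sum_desc Q M V \<phi> x = direct_sum_desc Q M V \<psi> x"
proof -
  interpret V: abelian_group V by fact
  show ?thesis
    unfolding direct_sum_desc_def using assms(2) by (intro V.finsum_cong' refl) auto
qed

lemma direct_sum_map:
  assumes mod: "\<And>q. q \<in> Q \<Longrightarrow> module R (M q)" and mod': "\<And>q. q \<in> Q \<Longrightarrow> module R (N q)"
    and \<eta>: "\<And>q. q \<in> Q \<Longrightarrow> \<eta> q \<in> module_hom R (M q) (N q)"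
  shows "(\<lambda>x. \<lambda>q\<in>Q. \<eta> q (x q)) \<in> module_hom R (direct_sum Q M) (direct_sum Q N)"
proof -
  have zero: "\<eta> q \<zero>\<^bsub>M q\<^esub> = \<zero>\<^bsub>N q\<^esub>" if "q \<in> Q" for q
    using abelian_group_hom.hom_zero[OF module_hom_group_hom[OF \<eta> mod mod']] that by blast
  note \<eta>D = module_homD[OF \<eta>]
  have "finite {q \<in> Q. \<eta> q (x q) \<noteq> \<zero>\<^bsub>N q\<^esub>}" if "x \<in> carrier (direct_sum Q M)" for x
    by (rule finite_subset[OF _ direct_sum_carrier_cases(2)[OF that]]) (auto simp: zero)
  then show ?thesis
    by (intro module_homI) (auto simp: direct_sum_sel \<eta>D fun_eq_iff cong: conj_cong)
qed

lemma direct_sum_desc_map: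
  assumes mod: "\<And>q. q \<in> Q \<Longrightarrow> module R (M q)" and mod': "\<And>q. q \<in> Q \<Longrightarrow> module R (N q)"
    and \<eta>: "\<And>q. q \<in> Q \<Longrightarrow> \<eta> q \<in> module_hom R (M q) (N q)"
    and V: "module R V" and \<phi>: "\<And>q. q \<in> Q \<Longrightarrow> \<phi> q \<in> module_hom R (N q) V"
    and x: "x \<in> carrier (direct_sum Q M)"
  shows "direct_sum_desc Q N V \<phi> (\<lambda>q\<in>Q. \<eta> q (x q)) = direct_sum_desc Q M V (\<lambda>q a. \<phi> q (\<eta> q a)) x"
proof -
  interpret V: module R V by fact
  let ?T = "{q \<in> Q. x q \<noteq> \<zero>\<^bsub>M q\<^esub>}"
  have zero: "\<eta> q \<zero>\<^bsub>M q\<^esub> = \<zero>\<^bsub>N q\<^esub>" if "q \<in> Q" for q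
    using abelian_group_hom.hom_zero[OF module_hom_group_hom[OF \<eta> mod mod']] that by blast
  \<comment> \<open>The maps \<open>\<eta> q\<close> may kill coordinates, so the sum is enlarged to
    the support of \<open>x\<close>.\<close>
  have "direct_sum_desc Q N V \<phi> (\<lambda>q\<in>Q. \<eta> q (x q)) = (\<Oplus>\<^bsub>V\<^esub>q\<in>?T. \<phi> q ((\<lambda>q\<in>Q. \<eta> q (x q)) q))"
  proof (rule direct_sum_desc_superset[OF mod' V \<phi>])
    show "(\<lambda>q\<in>Q. \<eta> q (x q)) \<in> carrier (direct_sum Q N)"
      using module_homD(1)[OF direct_sum_map[where M = M and \<eta> = \<eta>, OF mod mod' \<eta>] x] .
    show "finite ?T" by (rule direct_sum_carrier_cases(2)[OF x])
  qed (auto simp: zero)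
  also have "\<dots> = (\<Oplus>\<^bsub>V\<^esub>q\<in>?T. \<phi> q (\<eta> q (x q)))"
  proof (rule V.finsum_cong'[OF refl])
    show "(\<lambda>q. \<phi> q (\<eta> q (x q))) \<in> ?T \<rightarrow> carrier V"
      using module_homD(1)[OF \<phi> module_homD(1)[OF \<eta> direct_sum_carrier_cases(1)[OF x]]] by auto
  qed auto
  finally show ?thesis by (simp add: direct_sum_desc_def)
qed

section \<open>Colimits\<close>

lemma functor_onD:
  assumes "functor_on R Q F"
  shows "q \<in> Q \<Longrightarrow> module R (ob F q)"
    and "p \<in> Q \<Longrightarrow> q \<in> Q \<Longrightarrow> p \<le> q \<Longrightarrow> arr F p q \<in> module_hom R (ob F p) (ob F q)"
    and "p \<in> Q \<Longrightarrow> x \<in> carrier (ob F p) \<Longrightarrow> arr F p p x = x"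
    and "p \<in> Q \<Longrightarrow> q \<in> Q \<Longrightarrow> r \<in> Q \<Longrightarrow> p \<le> q \<Longrightarrow> q \<le> r \<Longrightarrow> x \<in> carrier (ob F p) \<Longrightarrow>
      arr F q r (arr F p q x) = arr F p r x"
  using assms by (simp_all add: functor_on_def)

lemma functor_on_subset: "functor_on R Q F \<Longrightarrow> Q' \<subseteq> Q \<Longrightarrow> functor_on R Q' F"
  by (simp add: functor_on_def subset_iff)

lemma nat_trans_onD:
  assumes "nat_trans_on R Q F G \<eta>"
  shows "q \<in> Q \<Longrightarrow> \<eta> q \<in> module_hom R (ob F q) (ob G q)"
    and "p \<in> Q \<Longrightarrow> q \<in> Q \<Longrightarrow> p \<le> q \<Longrightarrow> x \<in> carrier (ob F p) \<Longrightarrow>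
      \<eta> q (arr F p q x) = arr G p q (\<eta> p x)"
  using assms by (simp_all add: nat_trans_on_def)

section \<open>Cocones and the universal property of the colimit\<close>

definition cocone_on ::
  "('r, 'x) ring_scheme \<Rightarrow> 'p::order set \<Rightarrow> ('p, 'r, 'm) diagram \<Rightarrow> ('r, 'n) module \<Rightarrow>
   ('p \<Rightarrow> 'm \<Rightarrow> 'n) \<Rightarrow> bool" where
  "cocone_on R Q F V \<phi> \<longleftrightarrow>
     (\<forall>q\<in>Q. \<phi> q \<in> module_hom R (ob F q) V) \<and>
     (\<forall>p\<in>Q. \<forall>q\<in>Q. p \<le> q \<longrightarrow> (\<forall>x\<in>carrier (ob F p). \<phi> q (arr F p q x) = \<phi> p x))"

lemma cocone_onD:
  assumes "cocone_on R Q F V \<phi>"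
  shows "q \<in> Q \<Longrightarrow> \<phi> q \<in> module_hom R (ob F q) V"
    and "p \<in> Q \<Longrightarrow> q \<in> Q \<Longrightarrow> p \<le> q \<Longrightarrow> x \<in> carrier (ob F p) \<Longrightarrow> \<phi> q (arr F p q x) = \<phi> p x"
  using assms by (simp_all add: cocone_on_def)

lemma cocone_on_compose:
  assumes "cocone_on R Q G V \<phi>" "nat_trans_on R Q F G \<eta>"
  shows "cocone_on R Q F V (\<lambda>q x. \<phi> q (\<eta> q x))"
  unfolding cocone_on_def
proof (intro conjI ballI impI)
  note \<phi> = cocone_onD[OF assms(1)] and \<eta> = nat_trans_onD[OF assms(2)]
  show "(\<lambda>x. \<phi> q (\<eta> q x)) \<in> module_hom R (ob F q) V" if "q \<in> Q" for q
    using module_hom_comp[OF \<eta>(1) \<phi>(1)] that by blast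
  show "\<phi> q (\<eta> q (arr F p q x)) = \<phi> p (\<eta> p x)"
    if "p \<in> Q" "q \<in> Q" "p \<le> q" "x \<in> carrier (ob F p)" for p q x
    using that \<eta>(2)[OF that] \<phi>(2)[OF that(1-3)] module_homD(1)[OF \<eta>(1)] by simp
qed

definition colim_class ::
  "('r, 'x) ring_scheme \<Rightarrow> 'p::order set \<Rightarrow> ('p, 'r, 'm) diagram \<Rightarrow> ('p \<Rightarrow> 'm) \<Rightarrow> ('p \<Rightarrow> 'm) set" where
  "colim_class R Q F x = colim_relations R Q F +>\<^bsub>direct_sum Q (ob F)\<^esub> x"

lemma colim_in_class: "colim_in R Q F q x = colim_class R Q F (summand_in Q (ob F) q x)"
  by (simp add: colim_in_def colim_class_def)

context
  fixes R :: "('r, 'x) ring_scheme" and Q :: "'p::order set" and F :: "('p, 'r, 'm) diagram"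
  assumes cring: "cring R" and F: "functor_on R Q F"
begin

private abbreviation "D \<equiv> direct_sum Q (ob F)"
private abbreviation "rel \<equiv> colim_relations R Q F"

lemma module_functor_sum: "module R D"
  by (rule module_direct_sum[OF cring functor_onD(1)[OF F]])

interpretation D: module R D by (rule module_functor_sum)

lemma summand_in_hom: "q \<in> Q \<Longrightarrow> summand_in Q (ob F) q \<in> module_hom R (ob F q) D"
proof (rule module_homI)
  assume q: "q \<in> Q"
  fix x assume x: "x \<in> carrier (ob F q)"
  note mod = functor_onD(1)[OF F]
  note G = abelian_groupE[OF module.axioms(2)[OF mod]]
  show "summand_in Q (ob F) q x \<in> carrier D" by (rule summand_in_carrier[where M = "ob F", OF mod q x])
  show "summand_in Q (ob F) q (x \<oplus>\<^bsub>ob F q\<^esub> y) = summand_in Q (ob F) q x \<oplus>\<^bsub>D\<^esub> summand_in Q (ob F) q y" for y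
    by (auto simp: summand_in_def direct_sum_sel fun_eq_iff G(2,5))
  show "summand_in Q (ob F) q (r \<odot>\<^bsub>ob F q\<^esub> x) = r \<odot>\<^bsub>D\<^esub> summand_in Q (ob F) q x" if "r \<in> carrier R" for r
    using that by (auto simp: summand_in_def direct_sum_sel fun_eq_iff module.smult_r_null[OF mod])
qed

lemma submodule_colim_relations: "submodule rel R D"
  unfolding colim_relations_def Let_def
proof (rule submodule_Inter[OF D.module_axioms])
  \<comment> \<open>All relations lie in the carrier of the direct sum, so the carrier is one of the
    submodules intersected and the family is nonempty.\<close>
  have "summand_in Q (ob F) p x \<ominus>\<^bsub>D\<^esub> summand_in Q (ob F) q (arr F p q x) \<in> carrier D"
    if "p \<in> Q" "q \<in> Q" "p \<le> q" "x \<in> carrier (ob F p)" for p q x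
    using module_homD(1)[OF summand_in_hom] module_homD(1)[OF functor_onD(2)[OF F]] that by simp
  then show "{N. submodule N R D \<and> (\<forall>p\<in>Q. \<forall>q\<in>Q. p \<le> q \<longrightarrow> (\<forall>x\<in>carrier (ob F p).
      summand_in Q (ob F) p x \<ominus>\<^bsub>D\<^esub> summand_in Q (ob F) q (arr F p q x) \<in> N))} \<noteq> {}"
    using D.carrier_is_submodule by blast
qed auto

interpretation rel: abelian_subgroup rel D
  by (rule submodule_abelian_subgroup[OF D.module_axioms submodule_colim_relations])

text \<open>Serves as an induction principle: a property of all relations is proved by presenting it
  as a submodule that contains the generating ones. The submodule is a kernel in
  \<open>direct_sum_desc_relation\<close> and an image in
  \<open>boundary_of_relation\<close>.\<close>

lemma colim_relations_least:
  assumes "submodule N R D"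
    and "\<And>p q x. p \<in> Q \<Longrightarrow> q \<in> Q \<Longrightarrow> p \<le> q \<Longrightarrow> x \<in> carrier (ob F p) \<Longrightarrow>
      summand_in Q (ob F) p x \<ominus>\<^bsub>D\<^esub> summand_in Q (ob F) q (arr F p q x) \<in> N"
  shows "rel \<subseteq> N"
  unfolding colim_relations_def Let_def by (rule Inter_lower) (use assms in simp)

lemma colim_relationsI:
  assumes "p \<in> Q" "q \<in> Q" "p \<le> q" "x \<in> carrier (ob F p)"
  shows "summand_in Q (ob F) p x \<ominus>\<^bsub>D\<^esub> summand_in Q (ob F) q (arr F p q x) \<in> rel"
  unfolding colim_relations_def Let_def using assms by simp

lemma module_colim: "module R (colim R Q F)"
  unfolding colim_def by (rule module_quotient(1)[OF D.module_axioms submodule_colim_relations])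

interpretation K: module R "colim R Q F" by (rule module_colim)

lemma colim_class_hom: "colim_class R Q F \<in> module_hom R D (colim R Q F)"
  unfolding colim_def colim_class_def
  by (rule module_quotient(2)[OF D.module_axioms submodule_colim_relations])

lemma colim_carrierE:
  assumes "X \<in> carrier (colim R Q F)"
  obtains x where "x \<in> carrier D" "X = colim_class R Q F x"
  using assms by (auto simp: colim_def colim_class_def quotient_module_def A_RCOSETS_def')


lemma colim_class_zero_iff:
  assumes "x \<in> carrier D"
  shows "colim_class R Q F x = \<zero>\<^bsub>colim R Q F\<^esub> \<longleftrightarrow> x \<in> rel"
proof -
  have "\<zero>\<^bsub>colim R Q F\<^esub> = rel" by (simp add: colim_def quotient_module_def)
  then show ?thesis
    unfolding colim_class_def
    using assms D.a_coset_join2[OF assms rel.a_subgroup] rel.a_rcos_self[OF assms] by auto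
qed

lemma colim_in_hom: "q \<in> Q \<Longrightarrow> colim_in R Q F q \<in> module_hom R (ob F q) (colim R Q F)"
  unfolding colim_in_class using module_hom_comp[OF summand_in_hom colim_class_hom] .

lemma colim_in_cocone: "cocone_on R Q F (colim R Q F) (colim_in R Q F)"
  unfolding cocone_on_def
proof (intro conjI ballI impI colim_in_hom)
  fix p q x assume pq: "p \<in> Q" "q \<in> Q" "p \<le> q" and x: "x \<in> carrier (ob F p)"
  interpret c: abelian_group_hom D "colim R Q F" "colim_class R Q F"
    by (rule module_hom_group_hom[OF colim_class_hom D.module_axioms K.module_axioms])
  let ?x = "summand_in Q (ob F) p x" and ?y = "summand_in Q (ob F) q (arr F p q x)"
  have xy: "?x \<in> carrier D" "?y \<in> carrier D"
    using module_homD(1)[OF summand_in_hom] module_homD(1)[OF functor_onD(2)[OF F]] pq x by simp_all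
  have "colim_class R Q F (?x \<ominus>\<^bsub>D\<^esub> ?y) = \<zero>\<^bsub>colim R Q F\<^esub>"
    using colim_class_zero_iff[of "?x \<ominus>\<^bsub>D\<^esub> ?y"] colim_relationsI[OF pq x] xy by simp
  moreover have "?x = (?x \<ominus>\<^bsub>D\<^esub> ?y) \<oplus>\<^bsub>D\<^esub> ?y"
    using xy by (simp add: a_minus_def D.a_assoc D.l_neg)
  ultimately have "colim_class R Q F ?x = colim_class R Q F ?y"
    using xy c.hom_add[of "?x \<ominus>\<^bsub>D\<^esub> ?y" ?y] by simp
  then show "colim_in R Q F q (arr F p q x) = colim_in R Q F p x"
    by (simp add: colim_in_class)
qed

lemma colim_class_sum:
  assumes "x \<in> carrier D"
  shows "colim_class R Q F x = direct_sum_desc Q (ob F) (colim R Q F) (colim_in R Q F) x"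
  using functor_onD(1)[OF F] assms
proof (rule direct_sum_induct)
  note desc = direct_sum_desc_hom[OF functor_onD(1)[OF F] module_colim colim_in_hom]
  interpret c: abelian_group_hom D "colim R Q F" "colim_class R Q F"
    by (rule module_hom_group_hom[OF colim_class_hom D.module_axioms K.module_axioms])
  interpret d: abelian_group_hom D "colim R Q F" "direct_sum_desc Q (ob F) (colim R Q F) (colim_in R Q F)"
    by (rule module_hom_group_hom[OF desc D.module_axioms K.module_axioms])
  show "colim_class R Q F \<zero>\<^bsub>D\<^esub> = direct_sum_desc Q (ob F) (colim R Q F) (colim_in R Q F) \<zero>\<^bsub>D\<^esub>"
    by simp
  fix p a x
  assume *: "p \<in> Q" "a \<in> carrier (ob F p)" "x \<in> carrier D"
    "colim_class R Q F x = direct_sum_desc Q (ob F) (colim R Q F) (colim_in R Q F) x"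
  then show "colim_class R Q F (summand_in Q (ob F) p a \<oplus>\<^bsub>D\<^esub> x) =
      direct_sum_desc Q (ob F) (colim R Q F) (colim_in R Q F) (summand_in Q (ob F) p a \<oplus>\<^bsub>D\<^esub> x)"
    using module_homD(1)[OF summand_in_hom]
      direct_sum_desc_summand[where M = "ob F" and Q = Q, OF functor_onD(1)[OF F] module_colim colim_in_hom *(1,2)]
    by (simp add: colim_in_class)
qed

context
  fixes V :: "('r, 'n) module" and \<phi> :: "'p \<Rightarrow> 'm \<Rightarrow> 'n"
  assumes V: "module R V" and \<phi>: "cocone_on R Q F V \<phi>"
begin

interpretation V: module R V by (fact V)

private lemma sum_hom: "direct_sum_desc Q (ob F) V \<phi> \<in> module_hom R D V"
  by (rule direct_sum_desc_hom[OF functor_onD(1)[OF F] V cocone_onD(1)[OF \<phi>]])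

interpretation d: abelian_group_hom D V "direct_sum_desc Q (ob F) V \<phi>"
  by (rule module_hom_group_hom[OF sum_hom D.module_axioms V])

lemma direct_sum_desc_relation:
  assumes "x \<in> rel"
  shows "direct_sum_desc Q (ob F) V \<phi> x = \<zero>\<^bsub>V\<^esub>"
proof -
  have "rel \<subseteq> {x \<in> carrier D. direct_sum_desc Q (ob F) V \<phi> x = \<zero>\<^bsub>V\<^esub>}"
  proof (rule colim_relations_least[OF submodule_kernel[OF sum_hom D.module_axioms V]])
    fix p q x assume pq: "p \<in> Q" "q \<in> Q" "p \<le> q" and x: "x \<in> carrier (ob F p)"
    let ?x = "summand_in Q (ob F) p x" and ?y = "summand_in Q (ob F) q (arr F p q x)"
    have fx: "arr F p q x \<in> carrier (ob F q)" using module_homD(1)[OF functor_onD(2)[OF F]] pq x by simp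
    then have xy: "?x \<in> carrier D" "?y \<in> carrier D"
      using module_homD(1)[OF summand_in_hom] pq x by simp_all
    have desc: "direct_sum_desc Q (ob F) V \<phi> (summand_in Q (ob F) q a) = \<phi> q a"
      if "q \<in> Q" "a \<in> carrier (ob F q)" for q a
      by (rule direct_sum_desc_summand[where M = "ob F", OF functor_onD(1)[OF F] V cocone_onD(1)[OF \<phi>] that])
    have "direct_sum_desc Q (ob F) V \<phi> ?x = direct_sum_desc Q (ob F) V \<phi> ?y"
      using desc[OF pq(1) x] desc[OF pq(2) fx] cocone_onD(2)[OF \<phi> pq x] by simp
    then show "?x \<ominus>\<^bsub>D\<^esub> ?y \<in> {x \<in> carrier D. direct_sum_desc Q (ob F) V \<phi> x = \<zero>\<^bsub>V\<^esub>}"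
      using xy by (simp add: a_minus_def V.r_neg)
  qed
  with assms show ?thesis by blast
qed

lemma colim_desc_class:
  assumes "x \<in> carrier D"
  shows "colim_desc Q F V \<phi> (colim_class R Q F x) = direct_sum_desc Q (ob F) V \<phi> x"
proof -
  \<comment> \<open>\<open>the_elem\<close> is meaningful only on a singleton: representatives
    differ by relations, on which the sum vanishes, and the class contains \<open>x\<close>.\<close>
  have "direct_sum_desc Q (ob F) V \<phi> ` colim_class R Q F x = {direct_sum_desc Q (ob F) V \<phi> x}"
  proof (intro equalityI subsetI)
    fix v assume "v \<in> direct_sum_desc Q (ob F) V \<phi> ` colim_class R Q F x"
    then obtain n where "n \<in> rel" "v = direct_sum_desc Q (ob F) V \<phi> (n \<oplus>\<^bsub>D\<^esub> x)"
      by (auto simp: colim_class_def a_r_coset_def')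
    then show "v \<in> {direct_sum_desc Q (ob F) V \<phi> x}"
      using assms direct_sum_desc_relation rel.a_Hcarr by simp
  qed (use rel.a_rcos_self[OF assms] in \<open>auto simp: colim_class_def\<close>)
  then show ?thesis
    by (simp add: colim_desc_def direct_sum_desc_def)
qed

lemma colim_desc_in:
  assumes "q \<in> Q" "x \<in> carrier (ob F q)"
  shows "colim_desc Q F V \<phi> (colim_in R Q F q x) = \<phi> q x"
  using colim_desc_class module_homD(1)[OF summand_in_hom] assms
    direct_sum_desc_summand[where M = "ob F" and Q = Q, OF functor_onD(1)[OF F] V cocone_onD(1)[OF \<phi>] assms]
  by (simp add: colim_in_class)

lemma colim_desc_hom: "colim_desc Q F V \<phi> \<in> module_hom R (colim R Q F) V"
proof (rule module_homI)
  note c = module_homD[OF colim_class_hom]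
  fix X assume "X \<in> carrier (colim R Q F)"
  then obtain x where x: "x \<in> carrier D" "X = colim_class R Q F x" by (rule colim_carrierE)
  show "colim_desc Q F V \<phi> X \<in> carrier V" using x by (simp add: colim_desc_class)
  show "colim_desc Q F V \<phi> (X \<oplus>\<^bsub>colim R Q F\<^esub> Y) = colim_desc Q F V \<phi> X \<oplus>\<^bsub>V\<^esub> colim_desc Q F V \<phi> Y"
    if "Y \<in> carrier (colim R Q F)" for Y
  proof -
    from that obtain y where y: "y \<in> carrier D" "Y = colim_class R Q F y" by (rule colim_carrierE)
    show ?thesis using x y by (simp add: c(2)[symmetric] colim_desc_class)
  qed
  show "colim_desc Q F V \<phi> (r \<odot>\<^bsub>colim R Q F\<^esub> X) = r \<odot>\<^bsub>V\<^esub> colim_desc Q F V \<phi> X" if "r \<in> carrier R" for r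
    using x that by (simp add: c(3)[symmetric] colim_desc_class module_homD(3)[OF sum_hom])
qed

end

end

text \<open>Closure under scalars and negatives need not be imposed: when the
  \<open>\<phi> q\<close> are linear, multiples of generators are generators, and
  \<open>submodule_generated\<close> recovers both. Three rules keep the inductions short.\<close>

inductive_set generated :: "('r, 'n) module \<Rightarrow> ('i \<Rightarrow> ('r, 'm) module) \<Rightarrow> ('i \<Rightarrow> 'm \<Rightarrow> 'n) \<Rightarrow> 'i set \<Rightarrow> 'n set"
  for V M \<phi> A where
  zero: "\<zero>\<^bsub>V\<^esub> \<in> generated V M \<phi> A"
| gen: "q \<in> A \<Longrightarrow> x \<in> carrier (M q) \<Longrightarrow> \<phi> q x \<in> generated V M \<phi> A"
| add: "u \<in> generated V M \<phi> A \<Longrightarrow> v \<in> generated V M \<phi> A \<Longrightarrow> u \<oplus>\<^bsub>V\<^esub> v \<in> generated V M \<phi> A"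

lemma generated_mono: "A \<subseteq> B \<Longrightarrow> generated V M \<phi> A \<subseteq> generated V M \<phi> B"
proof
  fix v assume "A \<subseteq> B" "v \<in> generated V M \<phi> A"
  from this(2) show "v \<in> generated V M \<phi> B"
    by induction (use \<open>A \<subseteq> B\<close> in \<open>auto intro: generated.intros\<close>)
qed

text \<open>Passes from rule induction to coordinates. An image of a linear map is a submodule, and
  an element of it comes with a finite family, which is what \<open>bounding_costable\<close> starts
  from.\<close>

lemma generated_eq_direct_sum_desc:
  assumes mod: "\<And>q. q \<in> A \<Longrightarrow> module R (M q)" and V: "module R V"
    and \<phi>: "\<And>q. q \<in> A \<Longrightarrow> \<phi> q \<in> module_hom R (M q) V"
  shows "generated V M \<phi> A = direct_sum_desc A M V \<phi> ` carrier (direct_sum A M)"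
proof -
  interpret V: module R V by fact
  interpret D: module R "direct_sum A M" by (rule module_direct_sum[OF V.is_cring mod])
  interpret d: abelian_group_hom "direct_sum A M" V "direct_sum_desc A M V \<phi>"
    by (rule module_hom_group_hom[OF direct_sum_desc_hom[OF mod V \<phi>] D.module_axioms V])
  show ?thesis
  proof (intro equalityI subsetI)
    fix v assume "v \<in> generated V M \<phi> A"
    then show "v \<in> direct_sum_desc A M V \<phi> ` carrier (direct_sum A M)"
    proof induction
      case zero
      show ?case using imageI[OF D.zero_closed, of "direct_sum_desc A M V \<phi>"] by simp
    next
      case (gen q x)
      then show ?case
        using imageI[OF summand_in_carrier[where M = M, OF mod gen], of "direct_sum_desc A M V \<phi>"]
          direct_sum_desc_summand[where M = M and \<phi> = \<phi>, OF mod V \<phi> gen] by simp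
    next
      case (add u v)
      then obtain x y where "x \<in> carrier (direct_sum A M)" "y \<in> carrier (direct_sum A M)"
        "u = direct_sum_desc A M V \<phi> x" "v = direct_sum_desc A M V \<phi> y" by auto
      then show ?case using imageI[OF D.a_closed, of x y "direct_sum_desc A M V \<phi>"] by simp
    qed
  next
    fix v assume "v \<in> direct_sum_desc A M V \<phi> ` carrier (direct_sum A M)"
    then obtain x where x: "x \<in> carrier (direct_sum A M)" "v = direct_sum_desc A M V \<phi> x" by auto
    have "direct_sum_desc A M V \<phi> x \<in> generated V M \<phi> A"
      using mod x(1)
    proof (rule direct_sum_induct)
      show "direct_sum_desc A M V \<phi> \<zero>\<^bsub>direct_sum A M\<^esub> \<in> generated V M \<phi> A"
        by (simp add: generated.zero)
      fix p a x
      assume *: "p \<in> A" "a \<in> carrier (M p)" "x \<in> carrier (direct_sum A M)"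
        "direct_sum_desc A M V \<phi> x \<in> generated V M \<phi> A"
      then show "direct_sum_desc A M V \<phi> (summand_in A M p a \<oplus>\<^bsub>direct_sum A M\<^esub> x) \<in> generated V M \<phi> A"
        using direct_sum_desc_summand[where M = M and \<phi> = \<phi>, OF mod V \<phi> *(1,2)] summand_in_carrier[where M = M, OF mod *(1,2)]
          generated.add[OF generated.gen[where M = M and \<phi> = \<phi>, OF *(1,2)] *(4)] by simp
    qed
    with x show "v \<in> generated V M \<phi> A" by simp
  qed
qed

lemma generated_subset_carrier:
  assumes "module R V" "\<And>q. q \<in> A \<Longrightarrow> \<phi> q \<in> module_hom R (M q) V"
  shows "generated V M \<phi> A \<subseteq> carrier V"
proof
  interpret V: module R V by fact
  fix v assume "v \<in> generated V M \<phi> A"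
  then show "v \<in> carrier V"
    by induction (auto dest: module_homD(1)[OF assms(2)])
qed

lemma submodule_generated:
  assumes "module R V" "\<And>q. q \<in> A \<Longrightarrow> module R (M q)" "\<And>q. q \<in> A \<Longrightarrow> \<phi> q \<in> module_hom R (M q) V"
  shows "submodule (generated V M \<phi> A) R V"
proof -
  interpret V: module R V by fact
  interpret D: module R "direct_sum A M" by (rule module_direct_sum[OF V.is_cring assms(2)])
  have eq: "generated V M \<phi> A = direct_sum_desc A M V \<phi> ` carrier (direct_sum A M)"
    by (rule generated_eq_direct_sum_desc[where M = M and \<phi> = \<phi>, OF assms(2,1,3)])
  show ?thesis
    unfolding eq
    by (rule submodule_image[OF direct_sum_desc_hom[OF assms(2,1,3)] D.module_axioms assms(1)
          D.carrier_is_submodule])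
qed

lemma colim_generated:
  assumes "cring R" "functor_on R Q P"
  shows "carrier (colim R Q P) = generated (colim R Q P) (ob P) (colim_in R Q P) Q"
proof -
  note mod = functor_onD(1)[OF assms(2)] module_colim[OF assms] colim_in_hom[OF assms]
  show ?thesis
  proof (intro equalityI generated_subset_carrier[OF mod(2,3)] subsetI)
    fix X assume "X \<in> carrier (colim R Q P)"
    then obtain x where "x \<in> carrier (direct_sum Q (ob P))" "X = colim_class R Q P x"
      by (rule colim_carrierE[OF assms])
    then show "X \<in> generated (colim R Q P) (ob P) (colim_in R Q P) Q"
      using generated_eq_direct_sum_desc[where M = "ob P" and \<phi> = "colim_in R Q P", OF mod]
        colim_class_sum[OF assms] by auto
  qed
qed

section \<open>Projective functors\<close>

text \<open>The finitely supported families in copies of this module, indexed by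
  \<open>'p \<times> 'b\<close>, have exactly the element type that \<open>projective_on\<close>
  prescribes for the test functor \<open>E\<close>.\<close>

definition self_module :: "('r, 'x) ring_scheme \<Rightarrow> ('r, 'r) module" where
  "self_module R = \<lparr>carrier = carrier R, mult = mult R, one = one R, zero = zero R, add = add R,
     smult = mult R\<rparr>"

lemma self_module_simps [simp]:
  "carrier (self_module R) = carrier R" "\<zero>\<^bsub>self_module R\<^esub> = \<zero>\<^bsub>R\<^esub>"
  "add (self_module R) = add R" "smult (self_module R) = mult R"
  by (simp_all add: self_module_def)

lemma module_self:
  assumes "cring R"
  shows "module R (self_module R)"
proof -
  interpret cring R by fact
  have "abelian_group (self_module R)"
    by (rule abelian_groupI) (auto simp: a_ac intro: l_neg a_inv_closed)
  then show ?thesis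
    by (rule moduleI[OF assms]) (auto simp: l_distr r_distr m_assoc)
qed

lemma smult_hom:
  assumes "module R V" "v \<in> carrier V"
  shows "(\<lambda>r. r \<odot>\<^bsub>V\<^esub> v) \<in> module_hom R (self_module R) V"
proof -
  interpret V: module R V by fact
  show ?thesis
    using assms(2) by (intro module_homI) (auto simp: V.smult_l_distr V.smult_assoc1)
qed

text \<open>
  Lifting the identity of \<open>P\<close> along the canonical epimorphism from the free functor \<open>E\<close> yields
  \<open>\<sigma>\<close>.  All \<open>E(q)\<close> are submodules of one free module and the transition maps of \<open>E\<close> are
  inclusions, so \<open>\<sigma>\<close> is a cocone.
\<close>

definition free_terms ::
  "'p::order set \<Rightarrow> ('p, 'r, 'b) diagram \<Rightarrow> ('r, 'n) module \<Rightarrow> ('p \<Rightarrow> 'b \<Rightarrow> 'n) \<Rightarrow> 'p \<times> 'b \<Rightarrow> 'r \<Rightarrow> 'n" where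
  "free_terms Q P V \<phi> = (\<lambda>(p, a) r. if p \<in> Q \<and> a \<in> carrier (ob P p) then r \<odot>\<^bsub>V\<^esub> \<phi> p a else \<zero>\<^bsub>V\<^esub>)"

context
  fixes R :: "('r, 'x) ring_scheme" and Q :: "'p::order set" and P :: "('p, 'r, 'b) diagram"
  assumes cring: "cring R" and P: "functor_on R Q P"
begin

private abbreviation "S \<equiv> (\<lambda>_ :: 'p \<times> 'b. self_module R)"
private abbreviation "FD \<equiv> direct_sum UNIV S"
private abbreviation "desc V \<phi> \<equiv> direct_sum_desc UNIV S V (free_terms Q P V \<phi>)"

interpretation R: cring R by (rule cring)
interpretation D: module R FD by (rule module_direct_sum[OF cring module_self[OF cring]])

lemma free_terms_hom:
  assumes "module R V" "\<And>p a. p \<in> Q \<Longrightarrow> a \<in> carrier (ob P p) \<Longrightarrow> \<phi> p a \<in> carrier V"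
  shows "free_terms Q P V \<phi> s \<in> module_hom R (S s) V"
proof -
  obtain p a where s: "s = (p, a)" by force
  show ?thesis
  proof (cases "p \<in> Q \<and> a \<in> carrier (ob P p)")
    case True
    with smult_hom[OF assms(1) assms(2)[of p a]] show ?thesis by (simp add: free_terms_def s)
  next
    case False
    then have "free_terms Q P V \<phi> s = (\<lambda>r. \<zero>\<^bsub>V\<^esub>)" by (auto simp: free_terms_def s)
    then show ?thesis using zero_hom[OF module_self[OF cring] assms(1)] by simp
  qed
qed

lemma free_desc_hom:
  assumes "module R V" "\<And>p a. p \<in> Q \<Longrightarrow> a \<in> carrier (ob P p) \<Longrightarrow> \<phi> p a \<in> carrier V"
  shows "desc V \<phi> \<in> module_hom R FD V"
  by (rule direct_sum_desc_hom[OF module_self[OF cring] assms(1) free_terms_hom[OF assms]])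

text \<open>The equation \<open>eq\<close> is demanded only where \<open>f\<close> is nonzero: in
  both applications it holds only for indices \<open>p\<close> below a given element, and the
  support of \<open>f\<close> is confined to these.\<close>

lemma hom_free_desc:
  assumes h: "h \<in> module_hom R V W" and V: "module R V" and W: "module R W"
    and \<phi>: "\<And>p a. p \<in> Q \<Longrightarrow> a \<in> carrier (ob P p) \<Longrightarrow> \<phi> p a \<in> carrier V"
    and f: "f \<in> carrier FD"
    and eq: "\<And>p a. f (p, a) \<noteq> \<zero>\<^bsub>R\<^esub> \<Longrightarrow> p \<in> Q \<Longrightarrow> a \<in> carrier (ob P p) \<Longrightarrow> h (\<phi> p a) = \<psi> p a"
  shows "h (desc V \<phi> f) = desc W \<psi> f"
proof -
  interpret V: module R V by fact
  interpret W: module R W by fact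
  interpret h: abelian_group_hom V W h by (rule module_hom_group_hom) fact+
  have "h (desc V \<phi> f) = direct_sum_desc UNIV S W (\<lambda>s r. h (free_terms Q P V \<phi> s r)) f"
    by (rule hom_direct_sum_desc[OF module_self[OF cring] V free_terms_hom[OF V \<phi>] h W f])
  also have "\<dots> = desc W \<psi> f"
  proof (rule direct_sum_desc_cong[OF W.abelian_group_axioms])
    fix s :: "'p \<times> 'b" assume "f s \<noteq> \<zero>\<^bsub>S s\<^esub>"
    then have ne: "f s \<noteq> \<zero>\<^bsub>R\<^esub>" by simp
    obtain p a where s: "s = (p, a)" by force
    have fs: "f s \<in> carrier R" using direct_sum_carrier_cases(1)[OF f] by simp
    show "h (free_terms Q P V \<phi> s (f s)) = free_terms Q P W \<psi> s (f s) \<and>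
        free_terms Q P W \<psi> s (f s) \<in> carrier W"
    proof (cases "p \<in> Q \<and> a \<in> carrier (ob P p)")
      case True
      then have "h (\<phi> p a) = \<psi> p a" "\<psi> p a \<in> carrier W"
        using eq[of p a] ne s h.hom_closed[OF \<phi>[of p a]] by auto
      then show ?thesis
        using True fs \<phi>[of p a] module_homD(3)[OF h] by (simp add: free_terms_def s)
    next
      case False
      then show ?thesis by (auto simp: free_terms_def s)
    qed
  qed
  finally show ?thesis .
qed

section \<open>The canonical epimorphism from the free functor\<close>

private definition "N q = {f \<in> carrier FD. \<forall>p a. f (p, a) \<noteq> \<zero>\<^bsub>R\<^esub> \<longrightarrow> p \<in> Q \<and> p \<le> q \<and> a \<in> carrier (ob P p)}"

private definition "E = \<lparr>ob = (\<lambda>q. FD\<lparr>carrier := N q\<rparr>), arr = (\<lambda>_ _ f. f)\<rparr>"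

text \<open>The image in \<open>ob P q\<close> of the basis element at \<open>(p, a)\<close>. The
  default zero makes \<open>\<pi> q\<close> linear on all of \<open>FD\<close>; naturality in
  \<open>q\<close> relies on the support condition in \<open>N\<close>.\<close>

private definition "pt q p a = (if p \<le> q then arr P p q a else \<zero>\<^bsub>ob P q\<^esub>)"

private definition "\<pi> q = desc (ob P q) (pt q)"

private lemma pt_carrier:
  "q \<in> Q \<Longrightarrow> p \<in> Q \<Longrightarrow> a \<in> carrier (ob P p) \<Longrightarrow> pt q p a \<in> carrier (ob P q)"
  using abelian_groupE(2)[OF module.axioms(2)[OF functor_onD(1)[OF P]]]
    module_homD(1)[OF functor_onD(2)[OF P]] by (simp add: pt_def)

private lemma submodule_N: "submodule (N q) R FD"
proof (rule D.submoduleI)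
  show "\<zero>\<^bsub>FD\<^esub> \<in> N q" using D.zero_closed by (simp add: N_def) (simp add: direct_sum_sel)
next
  fix f g assume fg: "f \<in> N q" "g \<in> N q"
  have "(f \<oplus>\<^bsub>FD\<^esub> g) s = f s \<oplus>\<^bsub>R\<^esub> g s" for s by (simp add: direct_sum_sel)
  with fg show "f \<oplus>\<^bsub>FD\<^esub> g \<in> N q"
    unfolding N_def by (auto, (metis R.l_zero R.zero_closed)+)
next
  fix r f assume rf: "r \<in> carrier R" "f \<in> N q"
  have "(r \<odot>\<^bsub>FD\<^esub> f) s = r \<otimes>\<^bsub>R\<^esub> f s" for s by (simp add: direct_sum_sel)
  with rf show smult: "r \<odot>\<^bsub>FD\<^esub> f \<in> N q"
    unfolding N_def by (auto, (metis R.r_null)+)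
next
  fix f assume f: "f \<in> N q"
  then have "f \<in> carrier FD" by (simp add: N_def)
  \<comment> \<open>Negatives in \<open>FD\<close> are known only through the group axioms, so a
    coordinate is recovered from the sum of \<open>f\<close> and its negative.\<close>
  have "(\<ominus>\<^bsub>FD\<^esub> f) s = \<zero>\<^bsub>R\<^esub>" if "f s = \<zero>\<^bsub>R\<^esub>" for s
  proof -
    have "(\<ominus>\<^bsub>FD\<^esub> f \<oplus>\<^bsub>FD\<^esub> f) s = \<zero>\<^bsub>R\<^esub>" using D.l_neg[OF \<open>f \<in> carrier FD\<close>] by (simp add: direct_sum_sel(2))
    moreover have "(\<ominus>\<^bsub>FD\<^esub> f) s \<in> carrier R"
      using direct_sum_carrier_cases(1)[OF D.a_inv_closed[OF \<open>f \<in> carrier FD\<close>]] by simp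
    ultimately show ?thesis using that by (simp add: direct_sum_sel(3))
  qed
  with f show "\<ominus>\<^bsub>FD\<^esub> f \<in> N q" unfolding N_def by auto
qed (auto simp: N_def)

private lemma functor_E: "functor_on R Q E"
  unfolding functor_on_def
proof (intro conjI ballI impI)
  fix q show "module R (ob E q)"
    unfolding E_def using submodule.submodule_is_module[OF submodule_N D.module_axioms] by simp
next
  fix p q :: 'p assume "p \<le> q"
  then have "N p \<subseteq> N q" unfolding N_def by (auto dest: order_trans)
  then show "arr E p q \<in> module_hom R (ob E p) (ob E q)"
    by (intro module_homI) (auto simp: E_def)
qed (simp_all add: E_def)

private lemma \<pi>_hom: "q \<in> Q \<Longrightarrow> \<pi> q \<in> module_hom R FD (ob P q)"
  unfolding \<pi>_def by (rule free_desc_hom[OF functor_onD(1)[OF P] pt_carrier])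

private lemma nat_trans_\<pi>: "nat_trans_on R Q E P \<pi>"
  unfolding nat_trans_on_def
proof (intro conjI ballI impI)
  fix q assume "q \<in> Q"
  from module_homD[OF \<pi>_hom[OF this]] show "\<pi> q \<in> module_hom R (ob E q) (ob P q)"
    by (intro module_homI) (auto simp: E_def N_def)
next
  fix p q f assume pq: "p \<in> Q" "q \<in> Q" "p \<le> q" and f: "f \<in> carrier (ob E p)"
  have "arr P p q (desc (ob P p) (pt p) f) = desc (ob P q) (pt q) f"
  proof (rule hom_free_desc[OF functor_onD(2)[OF P pq] functor_onD(1)[OF P pq(1)]
        functor_onD(1)[OF P pq(2)] pt_carrier[OF pq(1)]])
    show "f \<in> carrier FD" using f by (simp add: E_def N_def)
    fix p' a assume "f (p', a) \<noteq> \<zero>\<^bsub>R\<^esub>" and a: "p' \<in> Q" "a \<in> carrier (ob P p')"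
    then have "p' \<le> p" using f by (simp add: E_def N_def)
    then show "arr P p q (pt p p' a) = pt q p' a"
      using functor_onD(4)[OF P a(1) pq(1,2) _ pq(3) a(2)] pq(3) by (auto simp: pt_def)
  qed
  then show "\<pi> q (arr E p q f) = arr P p q (\<pi> p f)" by (simp add: \<pi>_def E_def)
qed

private lemma epi_\<pi>: "epi_on Q E P \<pi>"
  unfolding epi_on_def
proof (intro ballI equalityI subsetI)
  fix q y assume "q \<in> Q" "y \<in> \<pi> q ` carrier (ob E q)"
  then show "y \<in> carrier (ob P q)"
    using module_homD(1)[OF nat_trans_onD(1)[OF nat_trans_\<pi>]] by blast
next
  fix q y assume q: "q \<in> Q" and y: "y \<in> carrier (ob P q)"
  \<comment> \<open>The basis element at \<open>(q, y)\<close> is sent to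
    \<open>arr P q q y\<close>, which is \<open>y\<close>.\<close>
  let ?f = "summand_in UNIV S (q, y) \<one>\<^bsub>R\<^esub>"
  have "?f \<in> carrier FD" by (rule summand_in_carrier[OF module_self[OF cring]]) auto
  then have f: "?f \<in> carrier (ob E q)"
    using q y by (auto simp: E_def N_def summand_in_def)
  have "\<pi> q ?f = free_terms Q P (ob P q) (pt q) (q, y) \<one>\<^bsub>R\<^esub>"
    unfolding \<pi>_def
    by (rule direct_sum_desc_summand[where M = S, OF module_self[OF cring] functor_onD(1)[OF P q]
          free_terms_hom[OF functor_onD(1)[OF P q] pt_carrier[OF q]]]) auto
  also have "\<dots> = y"
    using q y functor_onD(3)[OF P q y] module.smult_one[OF functor_onD(1)[OF P q] y]
    by (simp add: free_terms_def pt_def)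
  finally show "y \<in> \<pi> q ` carrier (ob E q)" using f by (metis imageI)
qed

context
  assumes proj: "projective_on R Q P"
begin

private lemma projective_lift:
  "\<exists>\<sigma>. cocone_on R Q P FD \<sigma> \<and> (\<forall>q\<in>Q. \<forall>x\<in>carrier (ob P q). \<sigma> q x \<in> N q \<and> \<pi> q (\<sigma> q x) = x)"
proof -
  have "nat_trans_on R Q P P (\<lambda>_ x. x)"
    unfolding nat_trans_on_def by (auto intro: module_homI)
  then obtain \<sigma> where \<sigma>: "nat_trans_on R Q P E \<sigma>"
    and id: "\<And>q x. q \<in> Q \<Longrightarrow> x \<in> carrier (ob P q) \<Longrightarrow> \<pi> q (\<sigma> q x) = x"
    using proj[unfolded projective_on_def, THEN conjunct2, rule_format, of E P \<pi> "\<lambda>_ x. x"]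
      functor_E P nat_trans_\<pi> epi_\<pi> by blast
  have "cocone_on R Q P FD \<sigma>"
    unfolding cocone_on_def
  proof (intro conjI ballI impI)
    fix q assume "q \<in> Q"
    from module_homD[OF nat_trans_onD(1)[OF \<sigma> this]] show "\<sigma> q \<in> module_hom R (ob P q) FD"
      by (intro module_homI) (auto simp: E_def N_def)
  qed (use nat_trans_onD(2)[OF \<sigma>] in \<open>simp add: E_def\<close>)
  moreover have "\<sigma> q x \<in> N q" if "q \<in> Q" "x \<in> carrier (ob P q)" for q x
    using module_homD(1)[OF nat_trans_onD(1)[OF \<sigma> that(1)] that(2)] by (simp add: E_def)
  ultimately show ?thesis using id by blast
qed

text \<open>As a cocone, \<open>\<sigma>\<close> descends to the colimit; followed by
  \<open>\<pi> q\<close> it gives a left inverse of the structure map at \<open>q\<close>.\<close>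

lemma projective_colim_in_inj:
  assumes "q \<in> Q"
  shows "inj_on (colim_in R Q P q) (carrier (ob P q))"
proof -
  obtain \<sigma> where \<sigma>: "cocone_on R Q P FD \<sigma>"
    and N_id: "\<forall>q\<in>Q. \<forall>x\<in>carrier (ob P q). \<sigma> q x \<in> N q \<and> \<pi> q (\<sigma> q x) = x"
    using projective_lift by blast
  have id: "\<pi> q (\<sigma> q x) = x" if "q \<in> Q" "x \<in> carrier (ob P q)" for q x
    using N_id that by blast
  show ?thesis
  proof (rule inj_on_inverseI)
    fix x assume "x \<in> carrier (ob P q)"
    then show "\<pi> q (colim_desc Q P FD \<sigma> (colim_in R Q P q x)) = x"
      using colim_desc_in[OF cring P D.module_axioms \<sigma> assms] id[OF assms] by simp
  qed
qed

text \<open>The colimit embeds in \<open>FD\<close> by \<open>?s\<close>, and \<open>?p\<close> is a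
  retraction. If \<open>u\<close> is spanned both by \<open>A\<close> and by \<open>B\<close>, the
  support of \<open>?s u\<close> lies over both, and \<open>u = ?p (?s u)\<close> is a sum of terms
  indexed by this support.\<close>

lemma projective_generated_Int:
  assumes A: "A \<subseteq> Q" "\<And>p q. p \<in> Q \<Longrightarrow> q \<in> A \<Longrightarrow> p \<le> q \<Longrightarrow> p \<in> A"
    and B: "B \<subseteq> Q" "\<And>p q. p \<in> Q \<Longrightarrow> q \<in> B \<Longrightarrow> p \<le> q \<Longrightarrow> p \<in> B"
    and u: "u \<in> generated (colim R Q P) (ob P) (colim_in R Q P) A"
      "u \<in> generated (colim R Q P) (ob P) (colim_in R Q P) B"
  shows "u \<in> generated (colim R Q P) (ob P) (colim_in R Q P) (A \<inter> B)"
proof -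
  let ?K = "colim R Q P" and ?in = "colim_in R Q P"
  let ?U = "generated ?K (ob P) ?in"
  interpret K: module R ?K by (rule module_colim[OF cring P])
  note in_hom = colim_in_hom[OF cring P]
  obtain \<sigma> where \<sigma>: "cocone_on R Q P FD \<sigma>"
    and N_id: "\<forall>q\<in>Q. \<forall>x\<in>carrier (ob P q). \<sigma> q x \<in> N q \<and> \<pi> q (\<sigma> q x) = x"
    using projective_lift by blast
  have id: "\<pi> q (\<sigma> q x) = x" if "q \<in> Q" "x \<in> carrier (ob P q)" for q x
    using N_id that by blast
  have N: "\<sigma> q x \<in> N q" if "q \<in> Q" "x \<in> carrier (ob P q)" for q x
    using N_id that by blast
  let ?s = "colim_desc Q P FD \<sigma>" and ?p = "desc ?K ?in"
  have s_in: "?s (?in q x) = \<sigma> q x" if "q \<in> Q" "x \<in> carrier (ob P q)" for q x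
    by (rule colim_desc_in[OF cring P D.module_axioms \<sigma> that])
  interpret s: abelian_group_hom ?K FD ?s
    by (rule module_hom_group_hom[OF colim_desc_hom[OF cring P D.module_axioms \<sigma>] K.module_axioms D.module_axioms])
  have in_carrier: "?in q x \<in> carrier ?K" if "q \<in> Q" "x \<in> carrier (ob P q)" for q x
    by (rule module_homD(1)[OF in_hom[OF that(1)] that(2)])
  interpret p: abelian_group_hom FD ?K ?p
    by (rule module_hom_group_hom[OF free_desc_hom[OF K.module_axioms in_carrier] D.module_axioms K.module_axioms])
  have U_carrier: "?U C \<subseteq> carrier ?K" if "C \<subseteq> Q" for C
    using that by (intro generated_subset_carrier[OF K.module_axioms in_hom]) auto
  \<comment> \<open>On a generator from \<open>q\<close>, pushing the terms of
    \<open>\<sigma> q x\<close> forward to \<open>q\<close> does not change their classes in the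
    colimit, and at \<open>q\<close> they add up to
    \<open>\<pi> q (\<sigma> q x) = x\<close>.\<close>
  have ps: "?p (?s v) = v" if "v \<in> ?U Q" for v
    using that
  proof induction
    case (gen q x)
    have "?in q (desc (ob P q) (pt q) (\<sigma> q x)) = desc ?K ?in (\<sigma> q x)"
    proof (rule hom_free_desc[OF in_hom[OF gen(1)] functor_onD(1)[OF P gen(1)] K.module_axioms
          pt_carrier[OF gen(1)]])
      show "\<sigma> q x \<in> carrier FD" using N[OF gen] by (simp add: N_def)
      fix p a assume "\<sigma> q x (p, a) \<noteq> \<zero>\<^bsub>R\<^esub>" and a: "p \<in> Q" "a \<in> carrier (ob P p)"
      then have "p \<le> q" using N[OF gen] by (simp add: N_def)
      then show "?in q (pt q p a) = ?in p a"
        using cocone_onD(2)[OF colim_in_cocone[OF cring P] a(1) gen(1) _ a(2)] by (simp add: pt_def)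
    qed
    then show ?case using id[OF gen] s_in[OF gen] by (simp add: \<pi>_def)
  next
    case (add u v)
    then show ?case using U_carrier[of Q] by (simp add: subset_iff)
  qed simp
  \<comment> \<open>Here lower sets are essential: \<open>\<sigma> q x\<close> is supported on
    indices below \<open>q\<close>, and these belong to \<open>C\<close> along with
    \<open>q\<close>.\<close>
  have supp: "p \<in> C \<and> a \<in> carrier (ob P p)"
    if "v \<in> ?U C" "?s v (p, a) \<noteq> \<zero>\<^bsub>R\<^esub>"
      and C: "C \<subseteq> Q" "\<And>p q. p \<in> Q \<Longrightarrow> q \<in> C \<Longrightarrow> p \<le> q \<Longrightarrow> p \<in> C" for C v p a
    using that(1,2)
  proof induction
    case zero
    then show ?case by (simp add: direct_sum_sel)
  next
    case (gen q x)
    then have "q \<in> Q" using C(1) by auto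
    with gen N[of q x] s_in[of q x] C(2)[of p q] show ?case by (auto simp: N_def)
  next
    case (add u v)
    have "?s u \<in> carrier FD" "?s v \<in> carrier FD" using add U_carrier[OF C(1)] by auto
    moreover have "?s (u \<oplus>\<^bsub>?K\<^esub> v) (p, a) = ?s u (p, a) \<oplus>\<^bsub>R\<^esub> ?s v (p, a)"
      using add U_carrier[OF C(1)] by (simp add: subset_iff) (simp add: direct_sum_sel)
    ultimately have "?s u (p, a) \<noteq> \<zero>\<^bsub>R\<^esub> \<or> ?s v (p, a) \<noteq> \<zero>\<^bsub>R\<^esub>"
      using add.prems by auto
    with add.IH show ?case by blast
  qed
  have "?U A \<subseteq> ?U Q" using A(1) by (rule generated_mono)
  with u have uQ: "u \<in> ?U Q" by blast
  then have su: "?s u \<in> carrier FD" using U_carrier[of Q] by auto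
  have "?p (?s u) \<in> ?U (A \<inter> B)"
    unfolding direct_sum_desc_def
  proof (rule submodule_finsum[OF K.module_axioms submodule_generated[OF K.module_axioms]])
    fix q assume "q \<in> A \<inter> B"
    then have "q \<in> Q" using A(1) by auto
    then show "module R (ob P q)" "?in q \<in> module_hom R (ob P q) ?K"
      using functor_onD(1)[OF P] in_hom by auto
  next
    show "finite {s \<in> UNIV. ?s u s \<noteq> \<zero>\<^bsub>S s\<^esub>}"
      using direct_sum_carrier_cases(2)[OF su] .
  next
    fix s assume "s \<in> {s \<in> UNIV. ?s u s \<noteq> \<zero>\<^bsub>S s\<^esub>}"
    moreover obtain p a where s: "s = (p, a)" by force
    ultimately have "?s u (p, a) \<noteq> \<zero>\<^bsub>R\<^esub>" by simp
    from supp[OF u(1) this A] supp[OF u(2) this B] have p: "p \<in> A \<inter> B" "a \<in> carrier (ob P p)" by simp_all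
    then have "p \<in> Q" using A(1) by auto
    have r: "?s u s \<in> carrier R" using direct_sum_carrier_cases(1)[OF su] by simp
    have "free_terms Q P ?K ?in s (?s u s) = ?in p (?s u s \<odot>\<^bsub>ob P p\<^esub> a)"
      using module_homD(3)[OF in_hom[OF \<open>p \<in> Q\<close>] r p(2)] p \<open>p \<in> Q\<close> by (simp add: free_terms_def s)
    moreover have "?s u s \<odot>\<^bsub>ob P p\<^esub> a \<in> carrier (ob P p)"
      by (rule module.smult_closed[OF functor_onD(1)[OF P \<open>p \<in> Q\<close>] r p(2)])
    ultimately show "free_terms Q P ?K ?in s (?s u s) \<in> ?U (A \<inter> B)"
      using p(1) generated.gen[where M = "ob P" and \<phi> = ?in and A = "A \<inter> B"] by metis
  qed
  then show ?thesis using ps[OF uQ] by simp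
qed

end

end

section \<open>The complex of colimits over lower sets\<close>

text \<open>\<open>down_closure\<close> is formed in the whole type; \<open>lower\<close> keeps the
  closure of a subset of \<open>Q\<close> inside \<open>Q\<close>.\<close>

locale lower_set_resolution =
  fixes R :: "('r, 'x) ring_scheme" and Q :: "'p::order set" and F :: "('p, 'r, 'm) diagram"
    and P :: "nat \<Rightarrow> ('p, 'r, 'b) diagram" and \<delta> :: "nat \<Rightarrow> 'p \<Rightarrow> 'b \<Rightarrow> 'b"
    and \<epsilon> :: "'p \<Rightarrow> 'b \<Rightarrow> 'm"
  assumes cring: "cring R" and lower: "p \<le> q \<Longrightarrow> q \<in> Q \<Longrightarrow> p \<in> Q" and F: "functor_on R Q F"
    and resolution: "projective_resolution R Q F P \<delta> \<epsilon>"
begin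

abbreviation "K n \<equiv> colim R Q (P n)"
abbreviation "inc n \<equiv> colim_in R Q (P n)"
text \<open>Indexed by the degree of the target, so that no subtraction occurs;
  \<open>homology_module\<close> indexes the same map by its source.\<close>

abbreviation "d n \<equiv> colim_map R Q (P (Suc n)) (P n) (\<delta> (Suc n))"

text \<open>
  Since the \<open>P n\<close> are projective, the colimit of \<open>P n\<close> over a lower set \<open>A\<close> embeds into that
  over \<open>Q\<close>; its image is \<open>U n A\<close>.
\<close>

abbreviation "U n A \<equiv> generated (K n) (ob (P n)) (inc n) A"

definition lower_in :: "'p set \<Rightarrow> bool" where
  "lower_in A \<longleftrightarrow> A \<subseteq> Q \<and> (\<forall>p q. p \<le> q \<longrightarrow> q \<in> A \<longrightarrow> p \<in> A)"

text \<open>Stands for H_{n+1}(A; F) = 0, computed in the subcomplex of the \<open>U n A\<close>;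
  the index is again that of the target.\<close>

definition acyclic :: "nat \<Rightarrow> 'p set \<Rightarrow> bool" where
  "acyclic n A \<longleftrightarrow> (\<forall>u\<in>U (Suc n) A. d n u = \<zero>\<^bsub>K n\<^esub> \<longrightarrow> (\<exists>w\<in>U (Suc (Suc n)) A. d (Suc n) w = u))"

text \<open>For C inside B this is injectivity of H_n(C; F) -> H_n(B; F): a chain over C that bounds
  over B already bounds over C.\<close>

definition bounding :: "nat \<Rightarrow> 'p set \<Rightarrow> 'p set \<Rightarrow> bool" where
  "bounding n C B \<longleftrightarrow> (\<forall>b\<in>U (Suc n) B. d n b \<in> U n C \<longrightarrow> (\<exists>w\<in>U (Suc n) C. d n w = d n b))"

lemma proj: "projective_on R Q (P n)"
  using resolution by (simp add: projective_resolution_def)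

lemma funct: "functor_on R Q (P n)"
  using proj[of n] by (simp add: projective_on_def)

lemma nat_trans_\<delta>: "nat_trans_on R Q (P (Suc n)) (P n) (\<delta> (Suc n))"
  using resolution by (simp add: projective_resolution_def)

lemma nat_trans_\<epsilon>: "nat_trans_on R Q (P 0) F \<epsilon>"
  using resolution by (simp add: projective_resolution_def)

lemma \<epsilon>_onto: "q \<in> Q \<Longrightarrow> \<epsilon> q ` carrier (ob (P 0) q) = carrier (ob F q)"
  using resolution by (simp add: projective_resolution_def epi_on_def)

lemma exact_0: "q \<in> Q \<Longrightarrow> \<delta> (Suc 0) q ` carrier (ob (P (Suc 0)) q) = {x \<in> carrier (ob (P 0) q). \<epsilon> q x = \<zero>\<^bsub>ob F q\<^esub>}"
  using resolution by (simp add: projective_resolution_def)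

lemma exact_Suc: "q \<in> Q \<Longrightarrow> \<delta> (Suc (Suc n)) q ` carrier (ob (P (Suc (Suc n))) q) =
    {x \<in> carrier (ob (P (Suc n)) q). \<delta> (Suc n) q x = \<zero>\<^bsub>ob (P n) q\<^esub>}"
  using resolution by (simp add: projective_resolution_def)

lemma module_P: "q \<in> Q \<Longrightarrow> module R (ob (P n) q)"
  by (rule functor_onD(1)[OF funct])

lemma module_K: "module R (K n)"
  by (rule module_colim[OF cring funct])

sublocale K: module R "K n" for n
  by (rule module_K)

lemma inc_hom: "q \<in> Q \<Longrightarrow> inc n q \<in> module_hom R (ob (P n) q) (K n)"
  by (rule colim_in_hom[OF cring funct])

lemma inc_inj: "q \<in> Q \<Longrightarrow> x \<in> carrier (ob (P n) q) \<Longrightarrow> y \<in> carrier (ob (P n) q) \<Longrightarrow>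
    inc n q x = inc n q y \<Longrightarrow> x = y"
  by (rule inj_onD[OF projective_colim_in_inj[OF cring funct proj, of q n]])

lemma d_cocone: "cocone_on R Q (P (Suc n)) (K n) (\<lambda>q x. inc n q (\<delta> (Suc n) q x))"
  by (rule cocone_on_compose[OF colim_in_cocone[OF cring funct] nat_trans_\<delta>])

lemma d_hom: "d n \<in> module_hom R (K (Suc n)) (K n)"
  unfolding colim_map_def by (rule colim_desc_hom[OF cring funct module_K d_cocone])

lemma d_inc:
  "q \<in> Q \<Longrightarrow> x \<in> carrier (ob (P (Suc n)) q) \<Longrightarrow> d n (inc (Suc n) q x) = inc n q (\<delta> (Suc n) q x)"
  unfolding colim_map_def by (rule colim_desc_in[OF cring funct module_K d_cocone])

sublocale d: abelian_group_hom "K (Suc n)" "K n" "d n" for n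
  by (rule module_hom_group_hom[OF d_hom module_K module_K])

lemma \<delta>_carrier:
  "q \<in> Q \<Longrightarrow> x \<in> carrier (ob (P (Suc n)) q) \<Longrightarrow> \<delta> (Suc n) q x \<in> carrier (ob (P n) q)"
  by (rule module_homD(1)[OF nat_trans_onD(1)[OF nat_trans_\<delta>]])

lemma U_submodule: "A \<subseteq> Q \<Longrightarrow> submodule (U n A) R (K n)"
  by (rule submodule_generated[OF module_K module_P inc_hom]) auto

lemma U_carrier: "A \<subseteq> Q \<Longrightarrow> U n A \<subseteq> carrier (K n)"
  using K.submoduleE(1)[OF U_submodule] .

lemma U_neg: "A \<subseteq> Q \<Longrightarrow> u \<in> U n A \<Longrightarrow> \<ominus>\<^bsub>K n\<^esub> u \<in> U n A"
  using K.submoduleE(3)[OF U_submodule] .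

lemma U_whole: "U n Q = carrier (K n)"
  by (rule colim_generated[OF cring funct, symmetric])

lemma d_U:
  assumes "A \<subseteq> Q" "u \<in> U (Suc n) A"
  shows "d n u \<in> U n A"
  using assms(2)
proof induction
  case (gen q x)
  then have "q \<in> Q" using assms(1) by auto
  then show ?case
    using d_inc[OF _ gen(2)] \<delta>_carrier[OF _ gen(2)]
      generated.gen[where M = "ob (P n)" and \<phi> = "inc n", OF gen(1)] by simp
next
  case (add u v)
  then have "d n (u \<oplus>\<^bsub>K (Suc n)\<^esub> v) = d n u \<oplus>\<^bsub>K n\<^esub> d n v"
    using U_carrier[OF assms(1), of "Suc n"] by (simp add: subset_iff)
  then show ?case using generated.add[OF add.IH] by simp
qed (simp add: generated.zero)

lemma d_d:
  assumes "u \<in> carrier (K (Suc (Suc n)))"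
  shows "d n (d (Suc n) u) = \<zero>\<^bsub>K n\<^esub>"
proof -
  have "u \<in> U (Suc (Suc n)) Q" using assms by (simp add: U_whole)
  then show ?thesis
  proof induction
    case (gen q x)
    have "\<delta> (Suc n) q (\<delta> (Suc (Suc n)) q x) = \<zero>\<^bsub>ob (P n) q\<^esub>"
      using exact_Suc[OF gen(1), of n] imageI[OF gen(2), of "\<delta> (Suc (Suc n)) q"] by auto
    moreover have "inc n q \<zero>\<^bsub>ob (P n) q\<^esub> = \<zero>\<^bsub>K n\<^esub>"
      by (rule abelian_group_hom.hom_zero[OF module_hom_group_hom[OF inc_hom module_P module_K]]) fact+
    ultimately show ?case
      using gen d_inc \<delta>_carrier by simp
  next
    case (add u v)
    then show ?case by (simp add: U_whole)
  qed simp
qed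

text \<open>All generators can be pushed forward to the maximum \<open>x\<close> and added
  there.\<close>

lemma U_principal:
  assumes x: "x \<in> Q" and u: "u \<in> U n (down_closure {x})"
  shows "\<exists>a\<in>carrier (ob (P n) x). u = inc n x a"
  using u
proof induction
  interpret i: abelian_group_hom "ob (P n) x" "K n" "inc n x"
    by (rule module_hom_group_hom[OF inc_hom module_P module_K]) fact+
  {
    case zero
    show ?case using i.hom_zero i.G.zero_closed by metis
  next
    case (gen q a)
    then have q: "q \<le> x" "q \<in> Q" using lower[OF _ x] by (auto simp: down_closure_def)
    then have "inc n q a = inc n x (arr (P n) q x a)"
      using cocone_onD(2)[OF colim_in_cocone[OF cring funct] q(2) x q(1) gen(2)] by simp
    moreover have "arr (P n) q x a \<in> carrier (ob (P n) x)"
      by (rule module_homD(1)[OF functor_onD(2)[OF funct q(2) x q(1)] gen(2)])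
    ultimately show ?case by blast
  next
    case (add u v)
    then obtain a b where "a \<in> carrier (ob (P n) x)" "b \<in> carrier (ob (P n) x)"
      "u = inc n x a" "v = inc n x b" by auto
    then show ?case by (intro bexI[of _ "a \<oplus>\<^bsub>ob (P n) x\<^esub> b"]) auto
  }
qed

section \<open>Acyclicity of principal lower sets and of unions\<close>

lemma lower_in_down_closure:
  assumes "S \<subseteq> Q"
  shows "lower_in (down_closure S)"
  unfolding lower_in_def
proof (intro conjI allI impI subsetI)
  fix p assume "p \<in> down_closure S"
  then show "p \<in> Q" using assms lower by (force simp: down_closure_def)
next
  fix p q assume "p \<le> q" "q \<in> down_closure S"
  then obtain s where "s \<in> S" "p \<le> s" using order_trans[of p q] by (auto simp: down_closure_def)
  then show "p \<in> down_closure S" by (auto simp: down_closure_def)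
qed

text \<open>Over a set with maximum \<open>x\<close> the complex is the resolution evaluated at
  \<open>x\<close>, where it is exact; \<open>inc_inj\<close> carries the vanishing of the
  differential from the colimit back to \<open>P n\<close> at \<open>x\<close>.\<close>

lemma acyclic_principal:
  assumes x: "x \<in> Q"
  shows "acyclic n (down_closure {x})"
  unfolding acyclic_def
proof (intro ballI impI)
  fix u assume u: "u \<in> U (Suc n) (down_closure {x})" "d n u = \<zero>\<^bsub>K n\<^esub>"
  obtain a where a: "a \<in> carrier (ob (P (Suc n)) x)" "u = inc (Suc n) x a"
    using U_principal[OF x u(1)] by blast
  interpret i: abelian_group_hom "ob (P n) x" "K n" "inc n x"
    by (rule module_hom_group_hom[OF inc_hom module_P module_K]) fact+
  have "inc n x (\<delta> (Suc n) x a) = inc n x \<zero>\<^bsub>ob (P n) x\<^esub>"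
    using u(2) a d_inc[OF x a(1)] by simp
  then have "\<delta> (Suc n) x a = \<zero>\<^bsub>ob (P n) x\<^esub>"
    using inc_inj[OF x \<delta>_carrier[OF x a(1)] i.G.zero_closed] by simp
  with a(1) have "a \<in> \<delta> (Suc (Suc n)) x ` carrier (ob (P (Suc (Suc n))) x)"
    using exact_Suc[OF x, of n] by blast
  then obtain b where b: "b \<in> carrier (ob (P (Suc (Suc n))) x)" "a = \<delta> (Suc (Suc n)) x b" by blast
  have "inc (Suc (Suc n)) x b \<in> U (Suc (Suc n)) (down_closure {x})"
    using b(1) generated.gen[where M = "ob (P (Suc (Suc n)))" and \<phi> = "inc (Suc (Suc n))"]
    by (simp add: down_closure_def)
  moreover have "d (Suc n) (inc (Suc (Suc n)) x b) = u"
    using d_inc[OF x b(1)] a(2) b(2) by simp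
  ultimately show "\<exists>w\<in>U (Suc (Suc n)) (down_closure {x}). d (Suc n) w = u" by blast
qed

text \<open>In positive degree a boundary is a cycle, so if it lies over \<open>C\<close>, the
  vanishing of the homology of \<open>C\<close> makes it a boundary there.\<close>

lemma bounding_acyclic:
  assumes "B \<subseteq> Q" "acyclic n C"
  shows "bounding (Suc n) C B"
  unfolding bounding_def
proof (intro ballI impI)
  fix b assume "b \<in> U (Suc (Suc n)) B" and C: "d (Suc n) b \<in> U (Suc n) C"
  then have "d n (d (Suc n) b) = \<zero>\<^bsub>K n\<^esub>" using U_carrier[OF assms(1)] d_d by blast
  with C assms(2) show "\<exists>w\<in>U (Suc (Suc n)) C. d (Suc n) w = d (Suc n) b"
    unfolding acyclic_def by blast
qed

lemma U_union:
  assumes "A \<subseteq> Q" "B \<subseteq> Q" "u \<in> U n (A \<union> B)"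
  shows "\<exists>a\<in>U n A. \<exists>b\<in>U n B. u = a \<oplus>\<^bsub>K n\<^esub> b"
  using assms(3)
proof induction
  note c = subsetD[OF U_carrier[OF assms(1)]] subsetD[OF U_carrier[OF assms(2)]]
  {
    case zero
    show ?case by (intro bexI[of _ "\<zero>\<^bsub>K n\<^esub>"]) (auto intro: generated.zero)
  next
    case (gen q x)
    have "inc n q x \<in> carrier (K n)"
      using gen assms(1,2) module_homD(1)[OF inc_hom] by auto
    moreover have "inc n q x \<in> U n A \<or> inc n q x \<in> U n B"
      using gen generated.gen[where M = "ob (P n)" and \<phi> = "inc n"] by blast
    ultimately show ?case
      using generated.zero K.r_zero K.l_zero by metis
  next
    case (add u v)
    then obtain a b a' b' where ab: "a \<in> U n A" "b \<in> U n B" "u = a \<oplus>\<^bsub>K n\<^esub> b"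
      "a' \<in> U n A" "b' \<in> U n B" "v = a' \<oplus>\<^bsub>K n\<^esub> b'" by blast
    then have "u \<oplus>\<^bsub>K n\<^esub> v = (a \<oplus>\<^bsub>K n\<^esub> a') \<oplus>\<^bsub>K n\<^esub> (b \<oplus>\<^bsub>K n\<^esub> b')"
      using c by (simp add: K.a_ac)
    then show ?case using generated.add[OF ab(1,4)] generated.add[OF ab(2,5)] by blast
  }
qed

text \<open>The diagram chase of Mayer--Vietoris. For a cycle \<open>a + b\<close> the connecting
  class is represented by \<open>d n b\<close>, which equals the negative of \<open>d n a\<close>
  and so lies over both sets. Once it is \<open>d n w\<close> with \<open>w\<close> over the
  intersection, \<open>a + w\<close> and \<open>b - w\<close> are cycles over \<open>A\<close> and
  over \<open>B\<close>.\<close>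

lemma acyclic_union:
  assumes A: "lower_in A" and B: "lower_in B" and acyc: "acyclic n A" "acyclic n B"
    and bound: "bounding n (A \<inter> B) B"
  shows "acyclic n (A \<union> B)"
  unfolding acyclic_def
proof (intro ballI impI)
  have AQ: "A \<subseteq> Q" "B \<subseteq> Q" "A \<inter> B \<subseteq> Q" using A B by (auto simp: lower_in_def)
  fix u assume u: "u \<in> U (Suc n) (A \<union> B)" "d n u = \<zero>\<^bsub>K n\<^esub>"
  obtain a b where ab: "a \<in> U (Suc n) A" "b \<in> U (Suc n) B" "u = a \<oplus>\<^bsub>K (Suc n)\<^esub> b"
    using U_union[OF AQ(1,2) u(1)] by blast
  have abK: "a \<in> carrier (K (Suc n))" "b \<in> carrier (K (Suc n))"
    using ab U_carrier[OF AQ(1)] U_carrier[OF AQ(2)] by blast+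
  then have sum: "d n a \<oplus>\<^bsub>K n\<^esub> d n b = \<zero>\<^bsub>K n\<^esub>" using u(2) ab(3) by simp
  then have "d n b = \<ominus>\<^bsub>K n\<^esub> d n a" using abK by (metis K.a_comm K.minus_equality d.hom_closed)
  then have "d n b \<in> U n A" using U_neg[OF AQ(1) d_U[OF AQ(1) ab(1)]] by simp
  moreover have "d n b \<in> U n B" by (rule d_U[OF AQ(2) ab(2)])
  \<comment> \<open>This is where the projectivity of \<open>P n\<close> is used.\<close>
  ultimately have "d n b \<in> U n (A \<inter> B)"
    using A B projective_generated_Int[OF cring funct proj, of A B]
    by (simp add: lower_in_def)
  then obtain w where w: "w \<in> U (Suc n) (A \<inter> B)" "d n w = d n b"
    using bound ab(2) unfolding bounding_def by blast
  have wAB: "w \<in> U (Suc n) A" "w \<in> U (Suc n) B"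
    by (rule subsetD[OF generated_mono w(1)], blast)+
  have wK: "w \<in> carrier (K (Suc n))" using wAB(1) U_carrier[OF AQ(1)] by blast
  have "a \<oplus>\<^bsub>K (Suc n)\<^esub> w \<in> U (Suc n) A" by (rule generated.add[OF ab(1) wAB(1)])
  moreover have "d n (a \<oplus>\<^bsub>K (Suc n)\<^esub> w) = \<zero>\<^bsub>K n\<^esub>" using abK wK w(2) sum by simp
  ultimately obtain s where s: "s \<in> U (Suc (Suc n)) A" "d (Suc n) s = a \<oplus>\<^bsub>K (Suc n)\<^esub> w"
    using acyc(1) unfolding acyclic_def by blast
  have "b \<oplus>\<^bsub>K (Suc n)\<^esub> (\<ominus>\<^bsub>K (Suc n)\<^esub> w) \<in> U (Suc n) B"
    by (rule generated.add[OF ab(2) U_neg[OF AQ(2) wAB(2)]])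
  moreover have "d n (b \<oplus>\<^bsub>K (Suc n)\<^esub> (\<ominus>\<^bsub>K (Suc n)\<^esub> w)) = \<zero>\<^bsub>K n\<^esub>"
    using abK wK w(2) by (simp add: K.r_neg)
  ultimately obtain t where t: "t \<in> U (Suc (Suc n)) B" "d (Suc n) t = b \<oplus>\<^bsub>K (Suc n)\<^esub> (\<ominus>\<^bsub>K (Suc n)\<^esub> w)"
    using acyc(2) unfolding acyclic_def by blast
  have st: "s \<in> U (Suc (Suc n)) (A \<union> B)" "t \<in> U (Suc (Suc n)) (A \<union> B)"
    by (rule subsetD[OF generated_mono s(1)] subsetD[OF generated_mono t(1)], blast)+
  have stK: "s \<in> carrier (K (Suc (Suc n)))" "t \<in> carrier (K (Suc (Suc n)))"
    using s(1) t(1) U_carrier[OF AQ(1)] U_carrier[OF AQ(2)] by blast+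
  have "a \<oplus>\<^bsub>K (Suc n)\<^esub> w \<oplus>\<^bsub>K (Suc n)\<^esub> (b \<oplus>\<^bsub>K (Suc n)\<^esub> (\<ominus>\<^bsub>K (Suc n)\<^esub> w)) = a \<oplus>\<^bsub>K (Suc n)\<^esub> b \<oplus>\<^bsub>K (Suc n)\<^esub> (w \<oplus>\<^bsub>K (Suc n)\<^esub> (\<ominus>\<^bsub>K (Suc n)\<^esub> w))"
    using abK wK by (simp add: K.a_ac del: K.add.r_inv)
  also have "\<dots> = u" using abK wK ab(3) by (simp add: K.r_neg)
  finally have "d (Suc n) (s \<oplus>\<^bsub>K (Suc (Suc n))\<^esub> t) = u" using stK s(2) t(2) by simp
  then show "\<exists>w\<in>U (Suc (Suc n)) (A \<union> B). d (Suc n) w = u"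
    using generated.add[OF st] by blast
qed

lemma acyclic_empty: "acyclic n {}"
proof -
  have "u = \<zero>\<^bsub>K (Suc n)\<^esub>" if "u \<in> U (Suc n) {}" for u
    using that by induction auto
  then show ?thesis
    unfolding acyclic_def using d.hom_zero generated.zero by metis
qed

text \<open>An element of \<open>U (Suc n) (\<Union>\<A>)\<close> involves finitely many generators,
  so it already lives over one member of the chain. This takes care of limit stages.\<close>

lemma acyclic_chain_union:
  assumes chain: "\<And>A B. A \<in> \<A> \<Longrightarrow> B \<in> \<A> \<Longrightarrow> A \<subseteq> B \<or> B \<subseteq> A"
    and acyc: "\<And>A. A \<in> \<A> \<Longrightarrow> acyclic n A"
  shows "acyclic n (\<Union>\<A>)"
proof (cases "\<A> = {}")
  \<comment> \<open>Without a member of \<open>\<A>\<close> not even zero would lie over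
    one.\<close>
  case False
  have ex: "\<exists>A\<in>\<A>. u \<in> U (Suc n) A" if "u \<in> U (Suc n) (\<Union>\<A>)" for u
    using that
  proof induction
    case zero
    from False obtain A where "A \<in> \<A>" by blast
    then show ?case using generated.zero by (rule bexI[rotated])
  next
    case (gen q x)
    then show ?case using generated.gen[where M = "ob (P (Suc n))" and \<phi> = "inc (Suc n)"] by blast
  next
    case (add u v)
    then obtain A B where AB: "A \<in> \<A>" "u \<in> U (Suc n) A" "B \<in> \<A>" "v \<in> U (Suc n) B" by blast
    then obtain C where "C \<in> \<A>" "A \<subseteq> C" "B \<subseteq> C" using chain[of A B] by blast
    moreover from this have "u \<in> U (Suc n) C" "v \<in> U (Suc n) C"
      using subsetD[OF generated_mono AB(2)] subsetD[OF generated_mono AB(4)] by simp_all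
    ultimately show ?case using generated.add by metis
  qed
  show ?thesis
    unfolding acyclic_def
  proof (intro ballI impI)
    fix u assume u: "u \<in> U (Suc n) (\<Union>\<A>)" "d n u = \<zero>\<^bsub>K n\<^esub>"
    then obtain A where A: "A \<in> \<A>" "u \<in> U (Suc n) A" using ex by blast
    then obtain w where "w \<in> U (Suc (Suc n)) A" "d (Suc n) w = u"
      using acyc[OF A(1)] u(2) unfolding acyclic_def by blast
    then show "\<exists>w\<in>U (Suc (Suc n)) (\<Union>\<A>). d (Suc n) w = u"
      using subsetD[OF generated_mono[OF Union_upper[OF A(1)]]] by (intro bexI[of _ w]) simp_all
  qed
qed (simp add: acyclic_empty)

text \<open>
  This is right exactness of the colimit over \<open>C\<close> at \<open>colim P 0\<close>, with the colimits of \<open>P 0\<close>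
  and \<open>P 1\<close> over \<open>C\<close> replaced by their images in \<open>K 0\<close> and \<open>K 1\<close>.
\<close>

lemma boundary_of_relation:
  assumes C: "C \<subseteq> Q" and y: "y \<in> carrier (direct_sum C (ob (P 0)))"
    and rel: "(\<lambda>q\<in>C. \<epsilon> q (y q)) \<in> colim_relations R C F"
  shows "direct_sum_desc C (ob (P 0)) (K 0) (inc 0) y \<in> d 0 ` U (Suc 0) C"
proof -
  let ?D = "direct_sum C (ob (P 0))" and ?DF = "direct_sum C (ob F)"
  let ?Y = "direct_sum_desc C (ob (P 0)) (K 0) (inc 0)"
  define e where "e = (\<lambda>x. \<lambda>q\<in>C. \<epsilon> q (x q))"
  let ?B = "d 0 ` U (Suc 0) C"
  have FC: "functor_on R C F" and PC: "functor_on R C (P 0)"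
    using functor_on_subset[OF F C] functor_on_subset[OF funct C] .
  note modP = functor_onD(1)[OF PC] and modF = functor_onD(1)[OF FC]
  have \<epsilon>: "\<epsilon> q \<in> module_hom R (ob (P 0) q) (ob F q)" if "q \<in> C" for q
    using nat_trans_onD(1)[OF nat_trans_\<epsilon>] that C by auto
  have inc: "inc 0 q \<in> module_hom R (ob (P 0) q) (K 0)" if "q \<in> C" for q
    using inc_hom that C by auto
  interpret D: module R ?D by (rule module_functor_sum[OF cring PC])
  interpret DF: module R ?DF by (rule module_functor_sum[OF cring FC])
  have e_hom: "e \<in> module_hom R ?D ?DF" unfolding e_def by (rule direct_sum_map[where M = "ob (P 0)", OF modP modF \<epsilon>])
  have Y_hom: "?Y \<in> module_hom R ?D (K 0)" by (rule direct_sum_desc_hom[OF modP module_K inc])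
  interpret e: abelian_group_hom ?D ?DF e
    by (rule module_hom_group_hom[OF e_hom D.module_axioms DF.module_axioms])
  interpret Y: abelian_group_hom ?D "K 0" ?Y
    by (rule module_hom_group_hom[OF Y_hom D.module_axioms module_K])
  have B: "submodule ?B R (K 0)"
    by (rule submodule_image[OF d_hom module_K module_K U_submodule[OF C]])
  \<comment> \<open>Families over \<open>F\<close> with some lift to \<open>P 0\<close> whose sum is
    a boundary. Since \<open>\<epsilon>\<close> is onto, a generating relation of \<open>F\<close>
    lifts to one of \<open>P 0\<close>, whose sum is zero. That the choice of the lift does not
    matter is shown afterwards.\<close>
  let ?N = "e ` {x \<in> carrier ?D. ?Y x \<in> ?B}"
  have "colim_relations R C F \<subseteq> ?N"
  proof (rule colim_relations_least[OF cring FC])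
    show "submodule ?N R ?DF"
      by (rule submodule_image[OF e_hom D.module_axioms DF.module_axioms
            submodule_vimage[OF Y_hom D.module_axioms module_K B]])
    fix p q z assume pq: "p \<in> C" "q \<in> C" "p \<le> q" and z: "z \<in> carrier (ob F p)"
    have pqQ: "p \<in> Q" "q \<in> Q" using pq C by auto
    obtain z' where z': "z' \<in> carrier (ob (P 0) p)" "z = \<epsilon> p z'" using \<epsilon>_onto[OF pqQ(1)] z by blast
    let ?a = "summand_in C (ob (P 0)) p z'" and ?b = "summand_in C (ob (P 0)) q (arr (P 0) p q z')"
    have arr: "arr (P 0) p q z' \<in> carrier (ob (P 0) q)"
      by (rule module_homD(1)[OF functor_onD(2)[OF PC pq] z'(1)])
    have ab: "?a \<in> carrier ?D" "?b \<in> carrier ?D"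
      using module_homD(1)[OF summand_in_hom[OF cring PC]] pq z'(1) arr by blast+
    have e_summand: "e (summand_in C (ob (P 0)) s v) = summand_in C (ob F) s (\<epsilon> s v)"
      if "s \<in> C" "v \<in> carrier (ob (P 0) s)" for s v
      using abelian_group_hom.hom_zero[OF module_hom_group_hom[OF \<epsilon> modP modF]]
      by (auto simp: e_def summand_in_def fun_eq_iff)
    have "?Y ?a = inc 0 p z'" "?Y ?b = inc 0 q (arr (P 0) p q z')"
      using direct_sum_desc_summand[where M = "ob (P 0)" and \<phi> = "inc 0", OF modP module_K inc]
        pq z'(1) arr by blast+
    then have "?Y ?a = ?Y ?b"
      using cocone_onD(2)[OF colim_in_cocone[OF cring funct] pqQ pq(3) z'(1)] by simp
    then have "?Y (?a \<ominus>\<^bsub>?D\<^esub> ?b) = \<zero>\<^bsub>K 0\<^esub>" using ab by (simp add: a_minus_def K.r_neg)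
    then have "?a \<ominus>\<^bsub>?D\<^esub> ?b \<in> {x \<in> carrier ?D. ?Y x \<in> ?B}" using ab submodule_zero[OF B] by simp
    moreover have "e (?a \<ominus>\<^bsub>?D\<^esub> ?b) = e ?a \<ominus>\<^bsub>?DF\<^esub> e ?b"
      using ab by (simp add: a_minus_def)
    moreover have "e ?a = summand_in C (ob F) p z" "e ?b = summand_in C (ob F) q (arr F p q z)"
      using e_summand[OF pq(1) z'(1)] e_summand[OF pq(2) arr] z'(2)
        nat_trans_onD(2)[OF nat_trans_\<epsilon> pqQ pq(3) z'(1)] by simp_all
    ultimately show "summand_in C (ob F) p z \<ominus>\<^bsub>?DF\<^esub> summand_in C (ob F) q (arr F p q z) \<in> ?N"
      using imageI[of "?a \<ominus>\<^bsub>?D\<^esub> ?b" "{x \<in> carrier ?D. ?Y x \<in> ?B}" e] by simp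
  qed
  then have "e y \<in> ?N" using rel by (auto simp: e_def)
  then obtain y' where y': "y' \<in> carrier ?D" "?Y y' \<in> ?B" "e y = e y'" by blast
  \<comment> \<open>Two lifts of the same family differ by coordinates in the kernel of
    \<open>\<epsilon>\<close>. By exactness these come from \<open>P 1\<close>, so the difference
    contributes a boundary.\<close>
  let ?t = "y \<ominus>\<^bsub>?D\<^esub> y'"
  have t: "?t \<in> carrier ?D" using y y'(1) by simp
  have "e ?t = \<zero>\<^bsub>?DF\<^esub>"
    using y y'(1,3) by (simp add: a_minus_def DF.r_neg)
  then have e_t_fun: "e ?t q = \<zero>\<^bsub>?DF\<^esub> q" for q by simp
  have e_t: "\<epsilon> q (?t q) = \<zero>\<^bsub>ob F q\<^esub>" if "q \<in> C" for q
    using e_t_fun[of q] that by (simp add: e_def direct_sum_sel(2))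
  have "?Y ?t \<in> ?B"
    unfolding direct_sum_desc_def
  proof (rule submodule_finsum[OF module_K B direct_sum_carrier_cases(2)[OF t]])
    fix q assume "q \<in> {q \<in> C. ?t q \<noteq> \<zero>\<^bsub>ob (P 0) q\<^esub>}"
    then have q: "q \<in> C" "q \<in> Q" using C by auto
    with e_t direct_sum_carrier_cases(1)[OF t q(1)]
    obtain w where w: "w \<in> carrier (ob (P (Suc 0)) q)" "?t q = \<delta> (Suc 0) q w"
      using exact_0[OF q(2)] by blast
    then have "inc 0 q (?t q) = d 0 (inc (Suc 0) q w)" using d_inc[OF q(2) w(1)] by simp
    then show "inc 0 q (?t q) \<in> ?B"
      using generated.gen[where M = "ob (P (Suc 0))" and \<phi> = "inc (Suc 0)", OF q(1) w(1)] by simp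
  qed
  then have "?Y ?t \<oplus>\<^bsub>K 0\<^esub> ?Y y' \<in> ?B" using y'(2) K.submoduleE(5)[OF B] by blast
  moreover have "?t \<oplus>\<^bsub>?D\<^esub> y' = y" using y y'(1) by (simp add: a_minus_def D.a_assoc D.l_neg)
  ultimately show ?thesis using Y.hom_add[OF t y'(1)] by simp
qed

text \<open>Write the boundary \<open>d 0 b\<close> as the sum of a family \<open>y\<close> over
  \<open>C\<close>. Pushed forward to \<open>x\<close> it becomes a value of
  \<open>\<delta> 1\<close>, which \<open>\<epsilon>\<close> kills; hence the class of
  \<open>\<epsilon>(y)\<close> in colim_C F goes to zero in F(x). By injectivity
  \<open>\<epsilon>(y)\<close> is a relation, and \<open>boundary_of_relation\<close> applies to
  \<open>y\<close>.\<close>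

lemma bounding_costable:
  assumes x: "x \<in> Q" and C: "C \<subseteq> down_closure {x}"
    and inj: "inj_on (colim_desc C F (ob F x) (\<lambda>q. arr F q x)) (carrier (colim R C F))"
  shows "bounding 0 C (down_closure {x})"
  unfolding bounding_def
proof (intro ballI impI)
  have CQ: "C \<subseteq> Q" using C lower[OF _ x] by (auto simp: down_closure_def)
  have Cx: "q \<le> x" if "q \<in> C" for q using C that by (auto simp: down_closure_def)
  have FC: "functor_on R C F" and PC: "functor_on R C (P 0)"
    using functor_on_subset[OF F CQ] functor_on_subset[OF funct CQ] .
  note modP = functor_onD(1)[OF PC] and modF = functor_onD(1)[OF FC]
  have inc: "inc 0 q \<in> module_hom R (ob (P 0) q) (K 0)" if "q \<in> C" for q
    using inc_hom that CQ by auto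
  have \<epsilon>: "\<epsilon> q \<in> module_hom R (ob (P 0) q) (ob F q)" if "q \<in> C" for q
    using nat_trans_onD(1)[OF nat_trans_\<epsilon>] that CQ by auto
  have arrP: "arr (P 0) q x \<in> module_hom R (ob (P 0) q) (ob (P 0) x)" if "q \<in> C" for q
    using functor_onD(2)[OF funct _ x] that CQ Cx by blast
  have arrF: "arr F q x \<in> module_hom R (ob F q) (ob F x)" if "q \<in> C" for q
    using functor_onD(2)[OF F _ x] that CQ Cx by blast
  have Fx: "module R (ob F x)" by (rule functor_onD(1)[OF F x])
  interpret Fx: module R "ob F x" by (rule Fx)
  interpret DF: module R "direct_sum C (ob F)" by (rule module_functor_sum[OF cring FC])
  fix b assume b: "b \<in> U (Suc 0) (down_closure {x})" "d 0 b \<in> U 0 C"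
  obtain b0 where b0: "b0 \<in> carrier (ob (P (Suc 0)) x)" "b = inc (Suc 0) x b0"
    using U_principal[OF x b(1)] by blast
  obtain y where y: "y \<in> carrier (direct_sum C (ob (P 0)))"
    "d 0 b = direct_sum_desc C (ob (P 0)) (K 0) (inc 0) y"
    using b(2) generated_eq_direct_sum_desc[where M = "ob (P 0)" and \<phi> = "inc 0", OF modP module_K inc] by blast
  \<comment> \<open>The family \<open>y\<close>, pushed forward to \<open>x\<close> and added up in
    \<open>ob (P 0) x\<close>; its image in \<open>K 0\<close> is \<open>d 0 b\<close>.\<close>
  let ?h = "direct_sum_desc C (ob (P 0)) (ob (P 0) x) (\<lambda>q. arr (P 0) q x) y"
  have h: "?h \<in> carrier (ob (P 0) x)"
    by (rule module_homD(1)[OF direct_sum_desc_hom[OF modP module_P[OF x] arrP] y(1)])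
  have "inc 0 x ?h = direct_sum_desc C (ob (P 0)) (K 0) (\<lambda>q a. inc 0 x (arr (P 0) q x a)) y"
    by (rule hom_direct_sum_desc[OF modP module_P[OF x] arrP inc_hom[OF x] module_K y(1)])
  also have "\<dots> = direct_sum_desc C (ob (P 0)) (K 0) (inc 0) y"
  proof (rule direct_sum_desc_cong[OF K.abelian_group_axioms])
    fix q assume q: "q \<in> C"
    have yq: "y q \<in> carrier (ob (P 0) q)" by (rule direct_sum_carrier_cases(1)[OF y(1) q])
    show "inc 0 x (arr (P 0) q x (y q)) = inc 0 q (y q) \<and> inc 0 q (y q) \<in> carrier (K 0)"
      using cocone_onD(2)[OF colim_in_cocone[OF cring funct] _ x Cx[OF q] yq] q CQ
        module_homD(1)[OF inc[OF q] yq] by auto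
  qed
  also have "\<dots> = inc 0 x (\<delta> (Suc 0) x b0)" using d_inc[OF x b0(1)] b0(2) y(2) by simp
  finally have "?h = \<delta> (Suc 0) x b0" using inc_inj[OF x h \<delta>_carrier[OF x b0(1)]] by simp
  then have \<epsilon>h: "\<epsilon> x ?h = \<zero>\<^bsub>ob F x\<^esub>" using exact_0[OF x] imageI[OF b0(1), of "\<delta> (Suc 0) x"] by auto
  let ?e = "\<lambda>q\<in>C. \<epsilon> q (y q)"
  have e: "?e \<in> carrier (direct_sum C (ob F))"
    by (rule module_homD(1)[OF direct_sum_map[where M = "ob (P 0)", OF modP modF \<epsilon>] y(1)])
  have cocone: "cocone_on R C F (ob F x) (\<lambda>q. arr F q x)"
    unfolding cocone_on_def
    using arrF functor_onD(4)[OF F _ _ x] Cx CQ by (auto simp: subset_iff)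
  have "\<epsilon> x ?h = direct_sum_desc C (ob (P 0)) (ob F x) (\<lambda>q a. \<epsilon> x (arr (P 0) q x a)) y"
    by (rule hom_direct_sum_desc[OF modP module_P[OF x] arrP nat_trans_onD(1)[OF nat_trans_\<epsilon> x] Fx y(1)])
  also have "\<dots> = direct_sum_desc C (ob (P 0)) (ob F x) (\<lambda>q a. arr F q x (\<epsilon> q a)) y"
  proof (rule direct_sum_desc_cong[OF Fx.abelian_group_axioms])
    fix q assume q: "q \<in> C"
    have yq: "y q \<in> carrier (ob (P 0) q)" by (rule direct_sum_carrier_cases(1)[OF y(1) q])
    show "\<epsilon> x (arr (P 0) q x (y q)) = arr F q x (\<epsilon> q (y q)) \<and> arr F q x (\<epsilon> q (y q)) \<in> carrier (ob F x)"
      using nat_trans_onD(2)[OF nat_trans_\<epsilon> _ x Cx[OF q] yq] q CQ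
        module_homD(1)[OF arrF[OF q] module_homD(1)[OF \<epsilon>[OF q] yq]] by auto
  qed
  also have "\<dots> = direct_sum_desc C (ob F) (ob F x) (\<lambda>q. arr F q x) ?e"
    by (rule direct_sum_desc_map[symmetric, where M = "ob (P 0)", OF modP modF \<epsilon> Fx arrF y(1)])
  also have "\<dots> = colim_desc C F (ob F x) (\<lambda>q. arr F q x) (colim_class R C F ?e)"
    by (rule colim_desc_class[OF cring FC Fx cocone e, symmetric])
  finally have "colim_desc C F (ob F x) (\<lambda>q. arr F q x) (colim_class R C F ?e) = \<zero>\<^bsub>ob F x\<^esub>"
    using \<epsilon>h by simp
  interpret KC: module R "colim R C F" by (rule module_colim[OF cring FC])
  interpret f: abelian_group_hom "colim R C F" "ob F x" "colim_desc C F (ob F x) (\<lambda>q. arr F q x)"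
    by (rule module_hom_group_hom[OF colim_desc_hom[OF cring FC Fx cocone] KC.module_axioms Fx])
  have "colim_class R C F ?e = \<zero>\<^bsub>colim R C F\<^esub>"
  proof (rule inj_onD[OF inj])
    show "colim_class R C F ?e \<in> carrier (colim R C F)"
      by (rule module_homD(1)[OF colim_class_hom[OF cring FC] e])
  qed (use \<open>colim_desc C F _ _ (colim_class R C F ?e) = _\<close> in auto)
  then have "?e \<in> colim_relations R C F" using colim_class_zero_iff[OF cring FC e] by simp
  from boundary_of_relation[OF CQ y(1) this] show "\<exists>w\<in>U (Suc 0) C. d 0 w = d 0 b"
    using y(2) by auto
qed

lemma higher_colim_trivial:
  assumes "acyclic n Q"
  shows "carrier (higher_colim R Q P \<delta> (Suc n)) = {\<zero>\<^bsub>higher_colim R Q P \<delta> (Suc n)\<^esub>}"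
proof -
  let ?Z = "{z \<in> carrier (K (Suc n)). d n z = \<zero>\<^bsub>K n\<^esub>}" and ?B = "d (Suc n) ` carrier (K (Suc (Suc n)))"
  have B: "submodule ?B R (K (Suc n))"
    by (rule submodule_image[OF d_hom module_K module_K K.carrier_is_submodule])
  interpret B: abelian_subgroup ?B "K (Suc n)"
    by (rule submodule_abelian_subgroup[OF module_K B])
  \<comment> \<open>Restricting the carrier to the cycles does not change cosets; as every cycle is
    a boundary, \<open>?B\<close> is the only one.\<close>
  have coset: "?B +>\<^bsub>(K (Suc n))\<lparr>carrier := ?Z\<rparr>\<^esub> z = ?B" if "z \<in> ?Z" for z
  proof -
    have "z \<in> ?B" using that assms unfolding acyclic_def U_whole by blast
    then have "?B +>\<^bsub>K (Suc n)\<^esub> z = ?B" using K.a_coset_join2[OF _ B.a_subgroup] that by blast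
    then show ?thesis by (simp add: a_r_coset_def')
  qed
  have "\<zero>\<^bsub>K (Suc n)\<^esub> \<in> ?Z" by simp
  then have "a_rcosets\<^bsub>(K (Suc n))\<lparr>carrier := ?Z\<rparr>\<^esub> ?B = {?B}"
    unfolding A_RCOSETS_def' using coset by auto
  then show ?thesis
    by (simp add: higher_colim_def homology_module_def quotient_module_def)
qed

end

section \<open>Induction along the coatom orderings\<close>

lemma top_chain_Cons: "top_chain c \<Longrightarrow> x \<lessdot> hd c \<Longrightarrow> top_chain (x # c)"
  by (auto simp: top_chain_def unrefinable_chain_def successively_Cons)

lemma covered_by_less: "p \<lessdot> q \<Longrightarrow> p < q"
  by (simp add: covered_by_def)

text \<open>The depth of elements below the maximum is bounded by that of the maximum itself. An
  element of greatest depth among those above \<open>p\<close> is a coatom, since depth is strictly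
  increasing.\<close>

lemma covered_by_top_exists:
  assumes "filtered_poset TYPE('p)" and "p \<noteq> (top_class.top :: 'p::{order,order_top})"
  shows "\<exists>q. p \<le> q \<and> q \<lessdot> top_class.top"
proof -
  have depth: "depth p < depth q" if "p < q" for p q :: 'p
    using assms(1) that by (simp add: filtered_poset_def)
  have "p \<le> p \<and> p < top_class.top" using assms(2) by (simp add: top.not_eq_extremum)
  moreover have "\<forall>q. p \<le> q \<and> q < top_class.top \<longrightarrow> depth q < depth (top_class.top :: 'p)"
    using depth by blast
  ultimately obtain q where q: "p \<le> q" "q < top_class.top"
    "\<forall>r. p \<le> r \<and> r < top_class.top \<longrightarrow> depth r \<le> depth q"
    using ex_has_greatest_nat[of "\<lambda>q. p \<le> q \<and> q < top_class.top" p depth "depth (top_class.top :: 'p)"]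
    by (blast intro: less_imp_le)
  then have "q \<lessdot> top_class.top"
    unfolding covered_by_def using depth by (meson leD less_imp_le order_trans)
  with q show ?thesis by blast
qed

lemma down_closure_Int_Cset:
  assumes L: "dual_CL_shellable L" and c: "top_chain c" and x: "x \<lessdot> hd c"
  shows "down_closure {y. y \<lessdot> hd c \<and> precedes L c y x} \<inter> down_closure {x} = down_closure (Cset L (x # c))"
proof -
  obtain c1 cs where cs: "c = c1 # cs"
    using c by (cases c) (auto simp: top_chain_def unrefinable_chain_def)
  have Cset: "Cset L (x # c) = {y. y \<lessdot> x \<and> (\<exists>h. h \<lessdot> hd c \<and> precedes L c h x \<and> y < h)}"
    by (simp add: cs)
  show ?thesis
  proof (intro equalityI subsetI)
    fix p assume "p \<in> down_closure {y. y \<lessdot> hd c \<and> precedes L c y x} \<inter> down_closure {x}"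
    then obtain h where h: "h \<lessdot> hd c" "precedes L c h x" "p \<le> h" and px: "p \<le> x"
      by (auto simp: down_closure_def)
    \<comment> \<open>Distinct elements covered by \<open>hd c\<close> are incomparable, so
      \<open>p\<close> lies strictly below both, as (CL2) requires.\<close>
    have "h \<noteq> x" using h(2) by (simp add: precedes_def)
    then have "\<not> h < x" "\<not> x < h"
      using h(1) x by (auto simp: covered_by_def)
    then have "p < h" "p < x" using h(3) px \<open>h \<noteq> x\<close> by (auto simp: le_less)
    then obtain h' q where "h' \<lessdot> hd c" "precedes L c h' x" "q \<lessdot> x" "p \<le> q" "q < h'"
      using L c h(1,2) x unfolding dual_CL_shellable_def by meson
    then show "p \<in> down_closure (Cset L (x # c))" by (auto simp: Cset down_closure_def)
  next
    fix p assume "p \<in> down_closure (Cset L (x # c))"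
    then obtain q h where "p \<le> q" "q \<lessdot> x" "h \<lessdot> hd c" "precedes L c h x" "q < h"
      by (auto simp: Cset down_closure_def)
    moreover from this have "p \<le> h" "p \<le> x"
      by (meson covered_by_less less_imp_le order_trans)+
    ultimately show "p \<in> down_closure {y. y \<lessdot> hd c \<and> precedes L c y x} \<inter> down_closure {x}"
      by (auto simp: down_closure_def)
  qed
qed

lemma down_closure_Un: "down_closure (A \<union> B) = down_closure A \<union> down_closure B"
  by (auto simp: down_closure_def)

lemma down_closure_mono: "A \<subseteq> B \<Longrightarrow> down_closure A \<subseteq> down_closure B"
  by (auto simp: down_closure_def)

text \<open>Closed segments \<open>seg x\<close> have a last element, so each arises from the strict
  predecessors of \<open>x\<close> by attaching \<open><x>\<close>, and Mayer--Vietoris applies. Any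
  other initial segment is the union of the closed segments it contains.\<close>

lemma (in lower_set_resolution) acyclic_well_order:
  assumes wo: "well_order_on A r" and A: "A \<subseteq> Q"
    and bound: "\<And>x. x \<in> A \<Longrightarrow>
      bounding n (down_closure {y \<in> A. (y, x) \<in> r \<and> y \<noteq> x} \<inter> down_closure {x}) (down_closure {x})"
    and S: "initial_segment A r S"
  shows "acyclic n (down_closure S)"
proof -
  define seg where "seg x = {y \<in> A. (y, x) \<in> r}" for x
  have lin: "linear_order_on A r" and wf: "wf (r - Id)"
    using wo by (auto simp: well_order_on_def)
  have trans: "trans r" and refl: "refl_on A r" and antisym: "antisym r" and total: "total_on A r"
    using lin by (auto simp: linear_order_on_def partial_order_on_def preorder_on_def)
  have seg_mono: "seg x \<subseteq> seg y" if "(x, y) \<in> r" for x y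
    using that transD[OF trans] by (auto simp: seg_def)
  \<comment> \<open>Used twice: for the strict predecessors of \<open>x\<close>, which need not have
    a last element, and for \<open>S\<close>.\<close>
  have union: "acyclic n (down_closure T)"
    if T: "initial_segment A r T" and acyc: "\<And>x. x \<in> T \<Longrightarrow> acyclic n (down_closure (seg x))" for T
  proof -
    have TA: "T \<subseteq> A" using T by (simp add: initial_segment_def)
    have "down_closure T = \<Union>((\<lambda>x. down_closure (seg x)) ` T)"
    proof
      show "down_closure T \<subseteq> \<Union>((\<lambda>x. down_closure (seg x)) ` T)"
        using TA refl by (auto simp: down_closure_def seg_def refl_on_def)
      have "seg x \<subseteq> T" if "x \<in> T" for x
        using that T by (auto simp: initial_segment_def seg_def)
      then show "\<Union>((\<lambda>x. down_closure (seg x)) ` T) \<subseteq> down_closure T"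
        using down_closure_mono by blast
    qed
    moreover have "acyclic n (\<Union>((\<lambda>x. down_closure (seg x)) ` T))"
    proof (rule acyclic_chain_union)
      fix X Y assume "X \<in> (\<lambda>x. down_closure (seg x)) ` T" "Y \<in> (\<lambda>x. down_closure (seg x)) ` T"
      then obtain x y where xy: "x \<in> T" "X = down_closure (seg x)" "y \<in> T" "Y = down_closure (seg y)"
        by blast
      then have "x \<in> A" "y \<in> A" using TA by auto
      then have "(x, y) \<in> r \<or> (y, x) \<in> r"
        using total refl by (cases "x = y") (auto simp: total_on_def refl_on_def)
      then show "X \<subseteq> Y \<or> Y \<subseteq> X"
        using xy seg_mono down_closure_mono by metis
    qed (use acyc in auto)
    ultimately show ?thesis by simp
  qed
  have "x \<in> A \<longrightarrow> acyclic n (down_closure (seg x))" for x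
  proof (induction x rule: wf_induct_rule[OF wf])
    case (1 x)
    show ?case
    proof
      assume x: "x \<in> A"
      let ?pre = "{y \<in> A. (y, x) \<in> r \<and> y \<noteq> x}"
      have "initial_segment A r ?pre"
        using transD[OF trans] antisymD[OF antisym] by (auto simp: initial_segment_def)
      then have pre: "acyclic n (down_closure ?pre)"
        by (rule union) (use 1 in auto)
      have "seg x = ?pre \<union> {x}" using x refl by (auto simp: seg_def refl_on_def)
      then have "down_closure (seg x) = down_closure ?pre \<union> down_closure {x}"
        by (simp only: down_closure_Un)
      moreover have "acyclic n (down_closure ?pre \<union> down_closure {x})"
        using x A by (intro acyclic_union lower_in_down_closure pre acyclic_principal bound) auto
      ultimately show "acyclic n (down_closure (seg x))" by simp
    qed
  qed
  moreover have "S \<subseteq> A" using S by (simp add: initial_segment_def)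
  ultimately show ?thesis using union[OF S] by blast
qed

theorem theorem3p5:
  fixes R :: "('r, 'x) ring_scheme"
    and L :: "'p::{order_bot,order_top} list \<Rightarrow> 'p rel"
    and F :: "('p, 'r, 'm) diagram"
    and P :: "nat \<Rightarrow> ('p, 'r, 'b) diagram"
    and \<delta> :: "nat \<Rightarrow> 'p \<Rightarrow> 'b \<Rightarrow> 'b"
    and \<epsilon> :: "'p \<Rightarrow> 'b \<Rightarrow> 'm"
    and i :: nat
  assumes "cring R"
    and "dual_CL_shellable L"
    and "1 \<le> i" and "i \<le> poset_depth TYPE('p) - 1"
    and "functor_on R UNIV F"
    and "co_stable_at R L F i"
    and "projective_resolution R (UNIV - {top_class.top}) F P \<delta> \<epsilon>"
  shows "carrier (higher_colim R (UNIV - {top_class.top}) P \<delta> i) = {\<zero>\<^bsub>higher_colim R (UNIV - {top_class.top}) P \<delta> i\<^esub>}"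
proof -
  let ?Q = "UNIV - {top_class.top :: 'p}"
  interpret lower_set_resolution R ?Q F P \<delta> \<epsilon>
    by (intro lower_set_resolution.intro assms(1,7) functor_on_subset[OF assms(5)])
      (auto simp: top.extremum_unique)
  note CL = assms(2)[unfolded dual_CL_shellable_def]
  have coatom_Q: "q \<in> ?Q" if "q \<lessdot> r" for q r :: 'p
    using that less_le_trans[OF covered_by_less[OF that] top_greatest[of r]] by auto
  \<comment> \<open>The list \<open>c\<close> is a chain of length \<open>length c - 1\<close> and
    \<open>acyclic n\<close> concerns degree \<open>n + 1\<close>, so degree and chain length always
    add up to \<open>i\<close>.\<close>
  have main: "acyclic n (down_closure S)"
    if "top_chain c" "length c + n = i" "initial_segment {q. q \<lessdot> hd c} (L c) S" for n c S
    using that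
  proof (induction n arbitrary: c S rule: less_induct)
    case (less n c S)
    note c = less.prems(1)
    have "well_order_on {q. q \<lessdot> hd c} (L c)"
      using CL c by (auto simp: coatom_ordering_def)
    then show ?case
    proof (rule acyclic_well_order[OF _ _ _ less.prems(3)])
      show "{q. q \<lessdot> hd c} \<subseteq> ?Q" using coatom_Q by blast
      fix x assume "x \<in> {q. q \<lessdot> hd c}"
      then have x: "x \<lessdot> hd c" by simp
      let ?C = "down_closure (Cset L (x # c))"
      have C: "down_closure {y \<in> {q. q \<lessdot> hd c}. (y, x) \<in> L c \<and> y \<noteq> x} \<inter> down_closure {x} = ?C"
        using down_closure_Int_Cset[OF assms(2) c x] by (simp add: precedes_def)
      have chain: "top_chain (x # c)" by (rule top_chain_Cons[OF c x])
      have "bounding n ?C (down_closure {x})"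
      proof (cases n)
        case 0
        \<comment> \<open>Now \<open>c\<close> has \<open>i\<close> entries, so \<open>x # c\<close>
          has \<open>Suc i\<close> of them and is a chain of length \<open>i\<close>, as
          co-stability requires.\<close>
        then have "inj_on (colim_desc ?C F (ob F x) (\<lambda>q. arr F q x)) (carrier (colim R ?C F))"
          using assms(6)[unfolded co_stable_at_def, rule_format, of "x # c"] chain less.prems(2) by simp
        then show ?thesis
          using bounding_costable[OF coatom_Q[OF x], of ?C] C 0 by blast
      next
        case (Suc m)
        \<comment> \<open>(CL1) for the longer chain puts \<open>Cset L (x # c)\<close> within reach
          of the induction hypothesis, one degree lower.\<close>
        have "initial_segment {q. q \<lessdot> hd (x # c)} (L (x # c)) (Cset L (x # c))"
          using CL chain by blast
        then have "acyclic m ?C"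
          using less.IH[of m "x # c"] Suc chain less.prems(2) by simp
        moreover have "down_closure {x} \<subseteq> ?Q"
          using lower_in_down_closure[of "{x}"] coatom_Q[OF x] by (simp add: lower_in_def)
        ultimately show ?thesis unfolding Suc by (intro bounding_acyclic)
      qed
      then show "bounding n (down_closure {y \<in> {q. q \<lessdot> hd c}. (y, x) \<in> L c \<and> y \<noteq> x} \<inter> down_closure {x})
          (down_closure {x})"
        unfolding C .
    qed
  qed
  obtain n where n: "i = Suc n" using assms(3) by (cases i) auto
  \<comment> \<open>The coatoms of the whole poset form the largest initial segment for the chain of
    length 0 and span everything below the maximum.\<close>
  have "down_closure {q. q \<lessdot> top_class.top} = ?Q"
  proof (intro equalityI subsetI)
    show "p \<in> ?Q" if "p \<in> down_closure {q. q \<lessdot> top_class.top}" for p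
      using that lower coatom_Q by (auto simp: down_closure_def)
    show "p \<in> down_closure {q. q \<lessdot> top_class.top}" if "p \<in> ?Q" for p
      using that covered_by_top_exists[of p] CL by (auto simp: down_closure_def)
  qed
  moreover have "acyclic n (down_closure {q. q \<lessdot> top_class.top})"
    using main[of "[top_class.top]" n "{q. q \<lessdot> top_class.top}"] n
    by (simp add: top_chain_def unrefinable_chain_def initial_segment_def)
  ultimately show ?thesis using higher_colim_trivial n by simp
qed

end
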